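(* Let $f\in\mathcal{C}$ be given by $f(z)=z+\sum_{n=2}^{\infty}a_nz^n$ for $z\in\mathbb{D}$. Then $$|H_{2,1}(F_{f^{-1}}/2)|\le \frac{1}{33},$$ where $H_{2,1}(F_{f^{-1}}/2)=\Gamma_1\Gamma_3-\Gamma_2^2$ and $\Gamma_n$ are the logarithmic inverse coefficients of $f$. The inequality is sharp, that is, there exists $f\in\mathcal{C}$ for which equality holds.
   Context: Let $\mathbb{D}=\{z\in\mathbb{C}:|z|<1\}$. $\mathcal{A}$ denotes the class of analytic functions $f$ in $\mathbb{D}$ with $f(0)=0$ and $f'(0)=1$, and $\mathcal{S}\subset\mathcal{A}$ is the subclass of functions that are univalent (one-to-one) in $\mathbb{D}$. $\mathcal{C}$ is the class of convex functions in $\mathcal{S}$, i.e. those $f\in\mathcal{S}$ for which $f(\mathbb{D})$ is a convex domain; equivalently, a function $f\in\mathcal{A}$ is in $\mathcal{C}$ if and only if $\mathrm{Re}\left(1+\frac{zf''(z)}{f'(z)}\right)>0$ for all $z\in\mathbb{D}$. For $f\in\mathcal{S}$, the inverse function $f^{-1}$ is defined and analytic in $|w|<1/4$ (by Koebe's $1/4$-theorem), with $f^{-1}(w)=w+\sum_{n=2}^\infty A_nw^n$. The logarithmic inverse coefficients $\Gamma_n$, $n\in\mathbb{N}$, of $f$ are defined by $$F_{f^{-1}}(w):=\log\frac{f^{-1}(w)}{w}=2\sum_{n=1}^{\infty}\Gamma_nw^n,\quad |w|<1/4,$$ where the branch of the logarithm is the analytic one with value $0$ at $w=0$. The second Hankel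 determinant of the logarithmic inverse coefficients is $H_{2,1}(F_{f^{-1}}/2):=\Gamma_1\Gamma_3-\Gamma_2^2$, which in terms of the coefficients of $f$ equals $\frac{1}{48}\left(13a_2^4-12a_2^2a_3-12a_3^2+12a_2a_4\right)$. *)

theory Defs
  imports "HOL-Complex_Analysis.Complex_Analysis"
begin

text \<open>
  Functions on the unit disc are total functions on \<^typ>\<open>complex\<close>; their values outside
  \<^term>\<open>ball 0 1\<close> are irrelevant.
\<close>

definition class_A :: "(complex \<Rightarrow> complex) set" where
  "class_A = {f. f holomorphic_on ball 0 1 \<and> f 0 = 0 \<and> deriv f 0 = 1}"

definition class_S :: "(complex \<Rightarrow> complex) set" where
  "class_S = {f \<in> class_A. inj_on f (ball 0 1)}"

definition class_C :: "(complex \<Rightarrow> complex) set" where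
  "class_C = {f \<in> class_S. convex (f ` ball 0 1)}"

definition disc_inverse :: "(complex \<Rightarrow> complex) \<Rightarrow> complex \<Rightarrow> complex" where
  "disc_inverse f = inv_into (ball 0 1) f"

text \<open>
  \<open>F\<close> is the analytic branch on \<open>|w| < 1/4\<close> of the logarithm of \<open>g w / w\<close> that vanishes at
  the origin. The point \<open>w = 0\<close>, a removable singularity of the quotient, is excluded because of
  the convention \<open>x / 0 = 0\<close>; there \<open>F 0 = 0\<close> fixes the branch.
\<close>

definition is_log_quotient :: "(complex \<Rightarrow> complex) \<Rightarrow> (complex \<Rightarrow> complex) \<Rightarrow> bool" where
  "is_log_quotient g F \<longleftrightarrow>
     F holomorphic_on ball 0 (1/4) \<and> F 0 = 0 \<and>
     (\<forall>w \<in> ball 0 (1/4) - {0}. exp (F w) = g w / w)"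

lemma is_log_quotient_unique:
  assumes F: "is_log_quotient g F" and G: "is_log_quotient g G" and w: "w \<in> ball 0 (1/4)"
  shows "F w = G w"
proof -
  define h where "h = (\<lambda>z. F z - G z)"
  have hol: "h holomorphic_on ball 0 (1/4)"
    using F G unfolding h_def is_log_quotient_def by (auto intro!: holomorphic_intros)
  have e: "exp (h z) = 1" if "z \<in> ball 0 (1/4)" for z
  proof (cases "z = 0")
    case True
    then show ?thesis using F G by (simp add: h_def is_log_quotient_def)
  next
    case False
    then have "exp (F z) = exp (G z)"
      using F G that by (simp add: is_log_quotient_def)
    then show ?thesis by (simp add: h_def exp_diff)
  qed
  have d0: "(h has_field_derivative 0) (at z)" if z: "z \<in> ball 0 (1/4)" for z
  proof -
    have dh: "(h has_field_derivative deriv h z) (at z)"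
      using hol z by (simp add: holomorphic_derivI)
    have 1: "((\<lambda>z. exp (h z)) has_field_derivative exp (h z) * deriv h z) (at z)"
      using DERIV_chain2[OF DERIV_exp dh] .
    have 2: "((\<lambda>z. exp (h z)) has_field_derivative 0) (at z)"
      by (rule has_field_derivative_transform_within_open[of "\<lambda>_. 1" 0 z "ball 0 (1/4)"])
         (use e z in auto)
    have "exp (h z) * deriv h z = 0" using DERIV_unique[OF 1 2] .
    then have "deriv h z = 0" by simp
    then show ?thesis using dh by simp
  qed
  have "h constant_on ball 0 (1/4)"
    by (rule has_field_derivative_0_imp_constant_on) (use d0 in auto)
  then have "h w = h 0"
    using w unfolding constant_on_def by auto
  then show ?thesis using F G by (simp add: h_def is_log_quotient_def)
qed

text \<open>
  The choice below is unique on \<open>|w| < 1/4\<close> by \<open>is_log_quotient_unique\<close>; for univalent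
  \<open>f\<close> it exists by Koebe's quarter theorem.
\<close>

definition log_inverse :: "(complex \<Rightarrow> complex) \<Rightarrow> complex \<Rightarrow> complex" where
  "log_inverse f = (SOME F. is_log_quotient (disc_inverse f) F)"

text \<open>\<open>log_inverse f w = 2 * (\<Sum>n. \<Gamma>\<^sub>n w\<^sup>n)\<close> on \<open>|w| < 1/4\<close>.\<close>

definition log_inverse_coeff :: "(complex \<Rightarrow> complex) \<Rightarrow> nat \<Rightarrow> complex" where
  "log_inverse_coeff f n = fps_nth (fps_expansion (log_inverse f) 0) n / 2"

definition hankel_2_1 :: "(nat \<Rightarrow> complex) \<Rightarrow> complex" where
  "hankel_2_1 \<gamma> = \<gamma> 1 * \<gamma> 3 - (\<gamma> 2)\<^sup>2"

end

theory Submission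
  imports Defs
begin

text \<open>
  Fix \<open>f\<close> convex and \<open>|z| < 1\<close>. For real \<open>t\<close> the point \<open>f\<^sup>-\<^sup>1 ((f (z e\<^sup>i\<^sup>t) + f (z e\<^sup>-\<^sup>i\<^sup>t)) / 2)\<close> exists by
  convexity and has modulus at most \<open>|z|\<close> by Schwarz's lemma, with equality at \<open>t = 0\<close>; the second
  derivative in \<open>t\<close> gives \<open>Re (1 + z f'' / f') \<ge> 0\<close>. Hence \<open>f'' = \<psi> (2 f' + z f'')\<close> for a Schur function
  \<open>\<psi>\<close>, and two steps of Schur's algorithm express \<open>a\<^sub>2, a\<^sub>3, a\<^sub>4\<close> by parameters \<open>w, x, y\<close> with \<open>|w| \<le> 1\<close>,
  \<open>|x| \<le> 1\<close>, \<open>|y| \<le> 1 - |x|\<^sup>2\<close>. For \<open>w = a \<ge> 0\<close> the determinant becomes 1/144 times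
  \<open>3 a\<^sup>4 - 6 a\<^sup>2 (1 - a\<^sup>2) x - 2 (1 - a\<^sup>2) (2 + a\<^sup>2) x\<^sup>2 + 6 a (1 - a\<^sup>2) y\<close>, whose modulus is at most
  \<open>4 + 4 a\<^sup>2 - 11 a\<^sup>4 \<le> 48/11\<close> in the critical range. Equality needs \<open>x = 1\<close> and \<open>a\<^sup>2 = 2/11\<close>, which leads to
  \<open>f z = (((1 + z) / (1 - z))\<^sup>a - 1) / (2 a)\<close>.
\<close>

section \<open>A quadratic form bound on the Schur parameters\<close>

text \<open>Since \<open>Re (x^2) = 2 (Re x)^2 - (norm x)^2\<close>, the modulus depends only on
  \<open>norm x\<close> and \<open>Re x\<close>. For fixed \<open>norm x\<close> its square is a
  quadratic in \<open>Re x\<close>, concave when \<open>A\<close> and \<open>B\<close> are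
  nonnegative.\<close>

lemma norm_quadratic_sq:
  fixes A B C :: real and x :: complex
  shows "(norm (A - C * x - B * x\<^sup>2))\<^sup>2 =
    (A + B * (norm x)\<^sup>2)\<^sup>2 + C\<^sup>2 * (norm x)\<^sup>2 + 2 * C * (B * (norm x)\<^sup>2 - A) * Re x - 4 * A * B * (Re x)\<^sup>2"
  unfolding cmod_power2 by (simp add: power2_eq_square) algebra

text \<open>The quadratic in \<open>Re x\<close> is bounded by its vertex value over all reals.
  Writing \<open>C^2 / (4 A B)\<close> as \<open>\<mu>\<close> avoids division, and
  \<open>(B r^2 - A)^2 + 4 A B r^2 = (A + B r^2)^2\<close> with \<open>r = norm x\<close> brings the
  vertex value into the stated form.\<close>

lemma norm_quadratic_le_discriminant:
  fixes A B C \<mu> :: real and x :: complex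
  assumes "0 \<le> A" "0 \<le> B" "0 \<le> \<mu>" and C: "C\<^sup>2 = 4 * A * B * \<mu>"
  shows "norm (A - C * x - B * x\<^sup>2) \<le> (A + B * (norm x)\<^sup>2) * sqrt (1 + \<mu>)"
proof -
  define Y where "Y = B * (norm x)\<^sup>2 - A"
  have "0 \<le> \<mu> * Y\<^sup>2 - 2 * C * Y * Re x + 4 * A * B * (Re x)\<^sup>2"
  proof (cases "\<mu> = 0")
    case True
    then show ?thesis using assms by simp
  next
    case False
    have "\<mu> * (\<mu> * Y\<^sup>2 - 2 * C * Y * Re x + 4 * A * B * (Re x)\<^sup>2) = (\<mu> * Y - C * Re x)\<^sup>2"
      using C by algebra
    then have "0 \<le> \<mu> * (\<mu> * Y\<^sup>2 - 2 * C * Y * Re x + 4 * A * B * (Re x)\<^sup>2)" by simp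
    then show ?thesis
      using False \<open>0 \<le> \<mu>\<close> unfolding zero_le_mult_iff by linarith
  qed
  moreover have "(A + B * (norm x)\<^sup>2)\<^sup>2 * (1 + \<mu>) - (norm (A - C * x - B * x\<^sup>2))\<^sup>2
      = \<mu> * Y\<^sup>2 - 2 * C * Y * Re x + 4 * A * B * (Re x)\<^sup>2"
    unfolding norm_quadratic_sq Y_def using C by algebra
  ultimately have "(norm (A - C * x - B * x\<^sup>2))\<^sup>2 \<le> ((A + B * (norm x)\<^sup>2) * sqrt (1 + \<mu>))\<^sup>2"
    using assms by (simp add: power_mult_distrib)
  then show ?thesis
    by (rule power2_le_imp_le) (use assms in simp)
qed

text \<open>Condition \<open>dom\<close> says that the concave quadratic in \<open>Re x\<close> is
  still nondecreasing at \<open>Re x = norm x\<close>, so its maximum on the circle is at the point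
  \<open>x = norm x\<close>.\<close>

lemma norm_quadratic_le_endpoint:
  fixes A B C :: real and x :: complex
  assumes "0 \<le> A" "0 \<le> B" "0 \<le> C" and dom: "4 * A * B * norm x \<le> C * (B * (norm x)\<^sup>2 - A)"
    and nonneg: "A \<le> B * (norm x)\<^sup>2"
  shows "norm (A - C * x - B * x\<^sup>2) \<le> B * (norm x)\<^sup>2 + C * norm x - A"
proof -
  define r X Y where "r = norm x" and "X = Re x" and "Y = B * (norm x)\<^sup>2 - A"
  have X: "X \<le> r" "- r \<le> X" and Y: "4 * A * B * r \<le> C * Y" and "0 \<le> r"
    using complex_Re_le_cmod[of x] abs_Re_le_cmod[of x] dom by (auto simp: X_def r_def Y_def)
  have "4 * A * B * (r + X) \<le> 4 * A * B * (2 * r)"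
    using X assms by (intro mult_left_mono) auto
  then have "4 * A * B * (r + X) \<le> 2 * C * Y" using Y by simp
  then have "0 \<le> (r - X) * (2 * C * Y - 4 * A * B * (r + X))"
    using X by simp
  moreover have "(B * r\<^sup>2 + C * r - A)\<^sup>2 - (norm (A - C * x - B * x\<^sup>2))\<^sup>2
      = (r - X) * (2 * C * Y - 4 * A * B * (r + X))"
    unfolding norm_quadratic_sq Y_def r_def[symmetric] X_def[symmetric] by algebra
  ultimately have "(norm (A - C * x - B * x\<^sup>2))\<^sup>2 \<le> (B * r\<^sup>2 + C * r - A)\<^sup>2"
    by linarith
  moreover have "0 \<le> B * r\<^sup>2 + C * r - A"
    using nonneg mult_nonneg_nonneg[OF \<open>0 \<le> C\<close> \<open>0 \<le> r\<close>] by (simp add: r_def)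
  ultimately show ?thesis unfolding r_def[symmetric]
    by (rule power2_le_imp_le)
qed

text \<open>The discriminant bound makes the estimate affine in \<open>\<rho> = (norm x)^2\<close>,
  so it is enough to check \<open>\<rho> = 1\<close> and \<open>\<rho> = 0\<close>.\<close>

lemma schur_form_bound_large:
  fixes a :: real and x :: complex
  assumes a: "0 \<le> a" "a \<le> 1" "1 / 4 \<le> a\<^sup>2" and x: "norm x \<le> 1"
  shows "norm (3 * (a\<^sup>2)\<^sup>2 - 6 * a\<^sup>2 * (1 - a\<^sup>2) * x - 2 * (1 - a\<^sup>2) * (2 + a\<^sup>2) * x\<^sup>2)
    + 6 * a * (1 - a\<^sup>2) * (1 - (norm x)\<^sup>2) \<le> 48 / 11"
proof -
  define s where "s = a\<^sup>2"
  \<comment> \<open>This is \<open>C^2 / (4 A B)\<close> for \<open>A = 3 s^2\<close>,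
    \<open>B = 2 (1 - s) (2 + s)\<close>, \<open>C = 6 s (1 - s)\<close>, with common factors
    cancelled.\<close>
  define \<mu> where "\<mu> = 3 * (1 - s) / (2 * (2 + s))"
  define K where "K = sqrt (1 + \<mu>)"
  define \<rho> where "\<rho> = (norm x)\<^sup>2"
  have s: "1 / 4 \<le> s" "s \<le> 1" using a by (auto simp: s_def power_le_one)
  have \<rho>: "0 \<le> \<rho>" "\<rho> \<le> 1" using x by (auto simp: \<rho>_def power_le_one)
  have \<mu>: "0 \<le> \<mu>" "\<mu> \<le> 1 / 2" and \<mu>1: "1 + \<mu> = (7 - s) / (2 * (2 + s))"
    using s by (auto simp: \<mu>_def field_simps)
  have "norm (complex_of_real (3 * s\<^sup>2) - complex_of_real (6 * s * (1 - s)) * x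
      - complex_of_real (2 * (1 - s) * (2 + s)) * x\<^sup>2) \<le> (3 * s\<^sup>2 + 2 * (1 - s) * (2 + s) * (norm x)\<^sup>2) * sqrt (1 + \<mu>)"
  proof (rule norm_quadratic_le_discriminant)
    show "(6 * s * (1 - s))\<^sup>2 = 4 * (3 * s\<^sup>2) * (2 * (1 - s) * (2 + s)) * \<mu>"
      using s by (simp add: \<mu>_def field_simps power2_eq_square)
  qed (use s \<mu> in auto)
  then have 1: "norm (3 * (a\<^sup>2)\<^sup>2 - 6 * a\<^sup>2 * (1 - a\<^sup>2) * x - 2 * (1 - a\<^sup>2) * (2 + a\<^sup>2) * x\<^sup>2)
      \<le> (3 * s\<^sup>2 + 2 * (1 - s) * (2 + s) * \<rho>) * K"
    by (simp add: K_def \<rho>_def s_def)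
  have K: "0 \<le> K" using \<mu> by (simp add: K_def)
  have K': "K \<le> 5 / 4"
    unfolding K_def by (rule real_le_lsqrt) (use \<mu> in \<open>simp_all add: power2_eq_square\<close>)
  have "(4 - 2 * s + s\<^sup>2) * K \<le> 48 / 11"
  proof (rule power2_le_imp_le)
    \<comment> \<open>Here \<open>4 - 2 s + s^2 = 3 + (1 - s)^2\<close>; the assumption
      \<open>s >= 1/4\<close> makes this at most \<open>57/16\<close>, which only just suffices
      below.\<close>
    have "(1 - s)\<^sup>2 \<le> (3 / 4)\<^sup>2" using s by (intro power_mono) auto
    then have "4 - 2 * s + s\<^sup>2 \<le> 57 / 16" by (simp add: power2_eq_square algebra_simps)
    moreover have "0 \<le> 4 - 2 * s + s\<^sup>2" using s by simp
    ultimately have "(4 - 2 * s + s\<^sup>2)\<^sup>2 \<le> (57 / 16)\<^sup>2" by (intro power_mono)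
    moreover have "1 + \<mu> \<le> 3 / 2" using \<mu> by simp
    ultimately have "(4 - 2 * s + s\<^sup>2)\<^sup>2 * (1 + \<mu>) \<le> (57 / 16)\<^sup>2 * (3 / 2)"
      using \<mu> by (intro mult_mono) auto
    also have "\<dots> \<le> (48 / 11)\<^sup>2" by (simp add: power2_eq_square)
    finally show "((4 - 2 * s + s\<^sup>2) * K)\<^sup>2 \<le> (48 / 11)\<^sup>2"
      using \<mu> by (simp add: K_def power_mult_distrib)
  qed simp
  then have "\<rho> * ((4 - 2 * s + s\<^sup>2) * K) \<le> \<rho> * (48 / 11)"
    using \<rho> by (intro mult_left_mono)
  moreover have "3 * s\<^sup>2 * K + 6 * a * (1 - s) \<le> 48 / 11"
  proof -
    have "3 * s\<^sup>2 * K \<le> 3 * s\<^sup>2 * (5 / 4)" using K' by (intro mult_left_mono) auto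
    \<comment> \<open>AM-GM bounds \<open>6 a (1 - s)\<close> by \<open>3 (1 - s^2)\<close>, so the
      value at \<open>\<rho> = 0\<close> is at most \<open>3 + 3/4 s^2\<close>.\<close>
    moreover have "a \<le> (1 + s) / 2"
      using sum_squares_bound[of a 1] by (simp add: s_def)
    then have "6 * a * (1 - s) \<le> 6 * ((1 + s) / 2) * (1 - s)" using s by (intro mult_right_mono) auto
    moreover have "s\<^sup>2 \<le> 1" using s by (simp add: power_le_one)
    ultimately show ?thesis by (simp add: power2_eq_square algebra_simps)
  qed
  then have "(1 - \<rho>) * (3 * s\<^sup>2 * K + 6 * a * (1 - s)) \<le> (1 - \<rho>) * (48 / 11)"
    using \<rho> by (intro mult_left_mono) auto
  ultimately have "(3 * s\<^sup>2 + 2 * (1 - s) * (2 + s) * \<rho>) * K + 6 * a * (1 - s) * (1 - \<rho>) \<le> 48 / 11"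
    by (simp add: power2_eq_square algebra_simps)
  then show ?thesis using 1 unfolding \<rho>_def s_def by linarith
qed

text \<open>Away from the unit circle the triangle inequality suffices. Near it the endpoint lemma
  applies, and the bound grows with \<open>norm x\<close> up to
  \<open>B + C - A = 4 + 4 s - 11 s^2\<close>, whose maximum \<open>48/11\<close> is at
  \<open>s = 2/11\<close>.\<close>

lemma schur_form_bound_small:
  fixes a :: real and x :: complex
  assumes a: "0 \<le> a" "a\<^sup>2 \<le> 1 / 4" and x: "norm x \<le> 1"
  shows "norm (3 * (a\<^sup>2)\<^sup>2 - 6 * a\<^sup>2 * (1 - a\<^sup>2) * x - 2 * (1 - a\<^sup>2) * (2 + a\<^sup>2) * x\<^sup>2)
    + 6 * a * (1 - a\<^sup>2) * (1 - (norm x)\<^sup>2) \<le> 48 / 11"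
proof -
  define s where "s = a\<^sup>2"
  define A where "A = 3 * s\<^sup>2"
  define B where "B = 2 * (1 - s) * (2 + s)"
  define C where "C = 6 * s * (1 - s)"
  define D where "D = 6 * a * (1 - s)"
  define r where "r = norm x"
  have s: "0 \<le> s" "s \<le> 1 / 4" using a by (auto simp: s_def)
  have r: "0 \<le> r" "r \<le> 1" using x by (auto simp: r_def)
  have a2: "a \<le> 1 / 2" by (rule power2_le_imp_le) (use a in \<open>auto simp: power2_eq_square\<close>)
  have ss: "s\<^sup>2 \<le> s / 4" using mult_left_mono[of s "1 / 4" s] s by (simp add: power2_eq_square)
  have A: "0 \<le> A" by (simp add: A_def)
  have C: "0 \<le> C" using s by (simp add: C_def)
  have B: "27 / 8 \<le> B" "B \<le> 4"
    using ss s unfolding B_def by (auto simp: algebra_simps power2_eq_square)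
  have D: "D \<le> 9 / 4"
  proof -
    \<comment> \<open>\<open>6 a (1 - a^2)\<close> increases on \<open>[0, 1/2]\<close>; its
      distance to the value \<open>9/4\<close> at \<open>1/2\<close> has the factor
      \<open>1/2 - a\<close>.\<close>
    have "0 \<le> (1 / 2 - a) * (3 / 4 - a / 2 - a * a)"
      using a a2 by (intro mult_nonneg_nonneg) (auto simp: power2_eq_square)
    moreover have "9 / 4 - D = 6 * ((1 / 2 - a) * (3 / 4 - a / 2 - a * a))"
      unfolding D_def s_def by (simp add: power2_eq_square field_simps)
    ultimately show ?thesis by linarith
  qed
  have "norm (A - C * x - B * x\<^sup>2) + D * (1 - r\<^sup>2) \<le> 48 / 11"
  proof (cases "r \<le> 7 / 8")
    case True
    have "norm (A - C * x - B * x\<^sup>2) \<le> A + C * r + B * r\<^sup>2"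
      using norm_triangle_ineq4[of "A - C * x" "B * x\<^sup>2"] norm_triangle_ineq4[of A "C * x"] A B C
      by (simp add: norm_mult norm_power r_def)
    moreover have "C * r \<le> C * (7 / 8)" using True C by (intro mult_left_mono)
    moreover have "(B - D) * r\<^sup>2 \<le> (B - D) * (7 / 8)\<^sup>2"
      using True r B D by (intro mult_left_mono power_mono) auto
    \<comment> \<open>\<open>135/256\<close> is \<open>9/4 (1 - (7/8)^2)\<close>, the bound for the
      contribution of \<open>D\<close> at \<open>r = 7/8\<close>.\<close>
    moreover have "A + 7 / 8 * C + 49 / 64 * B + 135 / 256 \<le> 48 / 11"
    proof -
      \<comment> \<open>The total coefficient of \<open>s^2\<close> is negative, so
        \<open>s^2\<close> may be replaced by its tangent at \<open>s = 1/4\<close>.\<close>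
      have "0 \<le> (1 - 4 * s)\<^sup>2" by simp
      then have "8 * s - 1 \<le> 16 * s\<^sup>2" by (simp add: power2_eq_square algebra_simps)
      moreover have "B = 4 - 2 * s - 2 * s\<^sup>2" "C = 6 * s - 6 * s\<^sup>2"
        unfolding B_def C_def by (simp_all add: power2_eq_square algebra_simps)
      ultimately show ?thesis
        using s(2) unfolding A_def by linarith
    qed
    ultimately show ?thesis using D by (simp add: power2_eq_square algebra_simps)
  next
    case False
    then have r78: "(7 / 8)\<^sup>2 \<le> r\<^sup>2" by (intro power_mono) auto
    have A3: "A \<le> 3 / 16" using ss s by (simp add: A_def)
    have Br: "(27 / 8) * (7 / 8)\<^sup>2 \<le> B * r\<^sup>2" using r78 B by (intro mult_mono) auto
    have "norm (A - C * x - B * x\<^sup>2) \<le> B * (norm x)\<^sup>2 + C * norm x - A"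
    proof (rule norm_quadratic_le_endpoint)
      \<comment> \<open>\<open>12 s^2 <= 3 s\<close> and \<open>2 + s <= 9/4\<close> give
        \<open>4 A B <= 9/4 C\<close>, while \<open>B r^2 - A\<close> is at least \<open>9/4\<close>
        once \<open>r >= 7/8\<close>.\<close>
      have "s * s \<le> s * (1 / 4)" using s by (intro mult_left_mono) auto
      then have "12 * s\<^sup>2 * (2 * (1 - s) * (2 + s)) \<le> 3 * s * (2 * (1 - s) * (9 / 4))"
        using s by (intro mult_mono[of "12 * s\<^sup>2"] mult_left_mono) (auto simp: power2_eq_square)
      then have AB: "4 * A * B \<le> C * (9 / 4)"
        by (simp add: A_def B_def C_def mult_ac)
      have "4 * A * B * r \<le> 4 * A * B * 1"
        using A B r by (intro mult_left_mono) auto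
      also have "\<dots> \<le> C * (9 / 4)" using AB by simp
      also have "\<dots> \<le> C * (B * r\<^sup>2 - A)"
        using Br A3 C by (intro mult_left_mono) (auto simp: power2_eq_square)
      finally show "4 * A * B * norm x \<le> C * (B * (norm x)\<^sup>2 - A)" by (simp add: r_def)
    qed (use A B C Br A3 in \<open>auto simp: r_def power2_eq_square\<close>)
    moreover have "C * r \<le> C * 1" using r C by (intro mult_left_mono)
    moreover have "(B - D) * r\<^sup>2 \<le> (B - D) * 1"
      using r B D by (intro mult_left_mono) (auto simp: power_le_one)
    moreover have "B + C - A \<le> 48 / 11"
    proof -
      have "0 \<le> 11 * (s - 2 / 11)\<^sup>2" by simp
      then show ?thesis unfolding A_def B_def C_def by (simp add: power2_eq_square algebra_simps)
    qed
    ultimately show ?thesis unfolding r_def by (simp add: algebra_simps)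
  qed
  then show ?thesis
    by (simp add: A_def B_def C_def D_def s_def r_def)
qed

text \<open>\<open>y\<close> enters linearly and costs at most its coefficient times
  \<open>1 - (norm x)^2\<close>; the rest depends on \<open>a\<close> and \<open>x\<close> alone and
  is split at \<open>a^2 = 1/4\<close>.\<close>

lemma schur_form_bound_real:
  fixes a :: real and x y :: complex
  assumes a: "0 \<le> a" "a \<le> 1" and x: "norm x \<le> 1" and y: "norm y \<le> 1 - (norm x)\<^sup>2"
  shows "norm (3 * a ^ 4 - 6 * a\<^sup>2 * (1 - a\<^sup>2) * x - 2 * (1 - a\<^sup>2) * (2 + a\<^sup>2) * x\<^sup>2
    + 6 * a * (1 - a\<^sup>2) * y) \<le> 48 / 11"
proof -
  let ?Q = "3 * (a\<^sup>2)\<^sup>2 - 6 * a\<^sup>2 * (1 - a\<^sup>2) * x - 2 * (1 - a\<^sup>2) * (2 + a\<^sup>2) * x\<^sup>2"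
  have q: "0 \<le> 1 - a\<^sup>2" using a by (simp add: power_le_one)
  have "norm (?Q + of_real (6 * a * (1 - a\<^sup>2)) * y) \<le> norm ?Q + norm (of_real (6 * a * (1 - a\<^sup>2)) * y)"
    by (rule norm_triangle_ineq)
  also have "norm (of_real (6 * a * (1 - a\<^sup>2)) * y) = 6 * a * (1 - a\<^sup>2) * norm y"
    using a q unfolding norm_mult norm_of_real by simp
  also have "\<dots> \<le> 6 * a * (1 - a\<^sup>2) * (1 - (norm x)\<^sup>2)"
    using a q y by (intro mult_left_mono) auto
  finally have "norm (?Q + of_real (6 * a * (1 - a\<^sup>2)) * y)
      \<le> norm ?Q + 6 * a * (1 - a\<^sup>2) * (1 - (norm x)\<^sup>2)" by simp
  also have "\<dots> \<le> 48 / 11"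
    using schur_form_bound_large[OF a _ x] schur_form_bound_small[OF a(1) _ x] by fastforce
  finally show ?thesis by simp
qed

text \<open>The form is homogeneous of degree 4 under the rotation \<open>w \<mapsto> e w\<close>, \<open>x \<mapsto> e\<^sup>2 x\<close>,
  \<open>y \<mapsto> e\<^sup>3 y\<close>, so \<open>w\<close> may be taken real.\<close>

lemma schur_form_bound:
  fixes w x y :: complex
  assumes w: "norm w \<le> 1" and x: "norm x \<le> 1" and y: "norm y \<le> 1 - (norm x)\<^sup>2"
  defines "q \<equiv> 1 - w * cnj w"
  shows "norm (3 * w ^ 4 - 6 * w\<^sup>2 * (q * x) - 4 * (q * x)\<^sup>2 + 6 * w * (q * (y - cnj w * x\<^sup>2))) \<le> 48 / 11"
proof -
  obtain e where e: "norm e = 1" "w = of_real (norm w) * e"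
    by (cases "w = 0") (auto intro: that[of 1] that[of "w / norm w"] simp: norm_divide)
  define a where "a = norm w"
  have ee: "e * cnj e = 1" using e(1) by (simp add: complex_norm_square[symmetric])
  define x' y' where "x' = cnj e ^ 2 * x" and "y' = cnj e ^ 3 * y"
  have xy: "x = e\<^sup>2 * x'" "y = e ^ 3 * y'"
    using ee unfolding x'_def y'_def by (simp_all flip: mult.assoc power_mult_distrib)
  have w_eq: "w = of_real a * e" using e by (simp add: a_def)
  have q_eq: "q = 1 - (of_real a)\<^sup>2"
    using ee unfolding q_def w_eq by (simp add: power2_eq_square)
  \<comment> \<open>The terms \<open>- 4 (q x)^2\<close> and \<open>- 6 w q cnj w x^2\<close> merge
    into \<open>- 2 q (2 + a^2) x^2\<close>, because \<open>q = 1 - a^2\<close>.\<close>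
  have "3 * w ^ 4 - 6 * w\<^sup>2 * (q * x) - 4 * (q * x)\<^sup>2 + 6 * w * (q * (y - cnj w * x\<^sup>2))
    = e ^ 4 * (3 * a ^ 4 - 6 * a\<^sup>2 * (1 - a\<^sup>2) * x' - 2 * (1 - a\<^sup>2) * (2 + a\<^sup>2) * x'\<^sup>2
    + 6 * a * (1 - a\<^sup>2) * y')"
    unfolding q_eq xy unfolding w_eq using ee by simp algebra
  moreover have "norm (3 * a ^ 4 - 6 * a\<^sup>2 * (1 - a\<^sup>2) * x' - 2 * (1 - a\<^sup>2) * (2 + a\<^sup>2) * x'\<^sup>2
    + 6 * a * (1 - a\<^sup>2) * y') \<le> 48 / 11"
    by (rule schur_form_bound_real)
      (use w x y e(1) in \<open>simp_all add: a_def x'_def y'_def norm_mult norm_power\<close>)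
  ultimately show ?thesis by (simp add: norm_mult norm_power e(1))
qed

section \<open>Coefficient relations\<close>

text \<open>If \<open>A\<close> is the series of \<open>f\<close>, then \<open>X exp \<Phi>\<close>
  is that of the inverse and \<open>\<Phi>\<close> is the logarithm of \<open>f^-1(w) / w\<close>.
  The relation \<open>E' = E \<Phi>'\<close> for \<open>E = exp \<Phi>\<close>, together with the
  first coefficients of the composition, links the two sets of coefficients.\<close>

lemma fps_log_inverse_hankel:
  fixes A \<Phi> :: "complex fps"
  assumes A: "fps_nth A 0 = 0" "fps_nth A 1 = 1" and \<Phi>: "fps_nth \<Phi> 0 = 0"
    and inv: "A oo (fps_X * (fps_exp 1 oo \<Phi>)) = fps_X"
  shows "fps_nth \<Phi> 1 * fps_nth \<Phi> 3 - (fps_nth \<Phi> 2)\<^sup>2 =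
    (13 * fps_nth A 2 ^ 4 - 12 * (fps_nth A 2)\<^sup>2 * fps_nth A 3 - 12 * (fps_nth A 3)\<^sup>2
      + 12 * fps_nth A 2 * fps_nth A 4) / 12"
proof -
  define E where "E = fps_exp 1 oo \<Phi>"
  have E0: "fps_nth E 0 = 1" by (simp add: E_def)
  have "fps_deriv E = E * fps_deriv \<Phi>"
    unfolding E_def by (simp add: fps_compose_deriv \<Phi>)
  then have D: "fps_nth (fps_deriv E) n = fps_nth (E * fps_deriv \<Phi>) n" for n by simp
  have e: "fps_nth E 1 = fps_nth \<Phi> 1"
    "2 * fps_nth E 2 = 2 * fps_nth \<Phi> 2 + fps_nth E 1 * fps_nth \<Phi> 1"
    "3 * fps_nth E 3 = 3 * fps_nth \<Phi> 3 + 2 * fps_nth E 1 * fps_nth \<Phi> 2 + fps_nth E 2 * fps_nth \<Phi> 1"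
    using D[of 0] D[of 1] D[of 2] E0 by (simp_all add: fps_mult_nth numeral_eq_Suc algebra_simps)
  have I: "(\<Sum>i=0..n. fps_nth A i * fps_nth (fps_X ^ i * E ^ i) n) = fps_nth fps_X n" for n
    using inv unfolding E_def[symmetric] by (simp flip: power_mult_distrib fps_compose_nth)
  have a: "fps_nth E 1 + fps_nth A 2 = 0"
    "fps_nth E 2 + 2 * fps_nth A 2 * fps_nth E 1 + fps_nth A 3 = 0"
    "fps_nth E 3 + fps_nth A 2 * (2 * fps_nth E 2 + (fps_nth E 1)\<^sup>2) + 3 * fps_nth A 3 * fps_nth E 1
      + fps_nth A 4 = 0"
    using I[of 2] I[of 3] I[of 4] A E0
    by (simp_all add: numeral_eq_Suc fps_X_power_mult_nth fps_mult_nth algebra_simps)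
  define p q r where "p = fps_nth \<Phi> 1" and "q = fps_nth \<Phi> 2" and "r = fps_nth \<Phi> 3"
  have e1: "fps_nth E 1 = p" and e2: "fps_nth E 2 = q + p\<^sup>2 / 2"
    using e(1,2) by (simp_all add: p_def q_def power2_eq_square field_simps)
  have e3: "fps_nth E 3 = r + p * q + p ^ 3 / 6"
    using e(3) unfolding e1 e2 p_def[symmetric] q_def[symmetric] r_def[symmetric]
    by (simp add: power2_eq_square power3_eq_cube field_simps)
  \<comment> \<open>The coefficients of \<open>A\<close> are expressed through those of
    \<open>\<Phi>\<close>, so that the claim becomes a polynomial identity in \<open>p\<close>,
    \<open>q\<close>, \<open>r\<close>.\<close>
  have a2: "fps_nth A 2 = - p"
    using a(1) unfolding e1 by (simp add: eq_neg_iff_add_eq_0 add.commute)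
  have a3: "fps_nth A 3 = 3 / 2 * p\<^sup>2 - q"
    using a(2) unfolding e1 e2 a2 by (simp add: eq_neg_iff_add_eq_0 power2_eq_square field_simps)
  have "24 * fps_nth A 4 = 96 * p * q - 24 * r - 64 * p ^ 3"
    using a(3) unfolding e1 e2 e3 a2 a3 by (simp add: power2_eq_square power3_eq_cube field_simps)
  then have a4: "fps_nth A 4 = (96 * p * q - 24 * r - 64 * p ^ 3) / 24"
    by (simp add: field_simps)
  show ?thesis
    unfolding a2 a3 a4 p_def[symmetric] q_def[symmetric] r_def[symmetric]
    by (simp add: power2_eq_square power3_eq_cube power4_eq_xxxx field_simps)
qed

lemma fps_convex_coeffs:
  fixes A \<Psi> :: "complex fps"
  assumes A: "fps_nth A 1 = 1"
    and ode: "fps_deriv (fps_deriv A) = \<Psi> * (2 * fps_deriv A + fps_X * fps_deriv (fps_deriv A))"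
  shows "fps_nth A 2 = fps_nth \<Psi> 0"
    and "3 * fps_nth A 3 = fps_nth \<Psi> 1 + 3 * (fps_nth \<Psi> 0)\<^sup>2"
    and "6 * fps_nth A 4 = fps_nth \<Psi> 2 + 5 * fps_nth \<Psi> 0 * fps_nth \<Psi> 1 + 6 * fps_nth \<Psi> 0 ^ 3"
proof -
  have O: "fps_nth (fps_deriv (fps_deriv A)) n =
      fps_nth (\<Psi> * (2 * fps_deriv A + fps_X * fps_deriv (fps_deriv A))) n" for n
    using ode by simp
  have "2 * fps_nth A 2 = 2 * fps_nth \<Psi> 0"
    "6 * fps_nth A 3 = 6 * (fps_nth \<Psi> 0)\<^sup>2 + 2 * fps_nth \<Psi> 1"
    "12 * fps_nth A 4 = 12 * fps_nth \<Psi> 0 ^ 3 + 10 * fps_nth \<Psi> 0 * fps_nth \<Psi> 1 + 2 * fps_nth \<Psi> 2"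
    using O[of 0] O[of 1] O[of 2] A
    by (simp_all add: numeral_eq_Suc fps_mult_nth fps_numeral_nth algebra_simps)
  then show "fps_nth A 2 = fps_nth \<Psi> 0"
    "3 * fps_nth A 3 = fps_nth \<Psi> 1 + 3 * (fps_nth \<Psi> 0)\<^sup>2"
    "6 * fps_nth A 4 = fps_nth \<Psi> 2 + 5 * fps_nth \<Psi> 0 * fps_nth \<Psi> 1 + 6 * fps_nth \<Psi> 0 ^ 3"
    by algebra+
qed

section \<open>Schur functions\<close>

definition schur_class :: "(complex \<Rightarrow> complex) set" where
  "schur_class = {f. f holomorphic_on ball 0 1 \<and> (\<forall>z \<in> ball 0 1. norm (f z) \<le> 1)}"

lemma schur_class_const:
  assumes f: "f \<in> schur_class" and z: "z \<in> ball 0 1" "norm (f z) = 1" and w: "w \<in> ball 0 1"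
  shows "f w = f z"
proof -
  have "f constant_on ball 0 1"
    by (rule maximum_modulus_principle[of f "ball 0 1" "ball 0 1" z])
      (use f z in \<open>auto simp: schur_class_def\<close>)
  then show ?thesis using z(1) w by (auto simp: constant_on_def)
qed

text \<open>The Schwarz lemma needs \<open>norm (f z) < 1\<close>; equality anywhere would make
  \<open>f\<close> constant of modulus 1, against \<open>f 0 = 0\<close>.\<close>

lemma schur_class_factor:
  assumes f: "f \<in> schur_class" and "f 0 = 0"
  shows "\<exists>g \<in> schur_class. \<forall>z \<in> ball 0 1. f z = z * g z"
proof -
  have holf: "f holomorphic_on ball 0 1" and le: "\<And>z. z \<in> ball 0 1 \<Longrightarrow> norm (f z) \<le> 1"
    using f by (auto simp: schur_class_def)
  have less: "norm (f z) < 1" if "norm z < 1" for z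
    using schur_class_const[OF f, of z 0] le[of z] that \<open>f 0 = 0\<close> by force
  obtain h where h: "h holomorphic_on ball 0 1" "\<And>z. norm z < 1 \<Longrightarrow> f z = z * h z" "deriv f 0 = h 0"
    using Schwarz3[OF holf \<open>f 0 = 0\<close>] by metis
  have "norm (h z) \<le> 1" if "norm z < 1" for z
  proof (cases "z = 0")
    case True
    then show ?thesis using Schwarz_Lemma(2)[OF holf \<open>f 0 = 0\<close> less, of 0] h(3) by simp
  next
    case False
    then show ?thesis
      using Schwarz_Lemma(1)[OF holf \<open>f 0 = 0\<close> less that] h(2)[OF that] by (simp add: norm_mult)
  qed
  then have "h \<in> schur_class" using h(1) by (simp add: schur_class_def)
  then show ?thesis using h(2) by auto
qed

lemma norm_moebius_le_1:
  fixes a b :: complex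
  assumes "norm a \<le> 1" "norm b \<le> 1"
  shows "norm (b - a) \<le> norm (1 - cnj a * b)"
proof -
  have "(norm (1 - cnj a * b))\<^sup>2 - (norm (b - a))\<^sup>2 = (1 - (norm a)\<^sup>2) * (1 - (norm b)\<^sup>2)"
    unfolding cmod_power2 by (simp add: power2_eq_square algebra_simps)
  also have "\<dots> \<ge> 0"
    using assms by (intro mult_nonneg_nonneg) (auto simp: power_le_one)
  finally show ?thesis by (intro power2_le_imp_le[OF _ norm_ge_zero]) simp
qed

text \<open>One step of Schur's algorithm: the disc automorphism sending \<open>f 0\<close> to 0 is
  applied to \<open>f\<close>, and a factor \<open>z\<close> is split off. With the denominator
  multiplied out, unimodular constants are covered too, by \<open>g = 0\<close>.\<close>

lemma schur_class_step:
  assumes f: "f \<in> schur_class"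
  shows "\<exists>g \<in> schur_class. \<forall>z \<in> ball 0 1. f z - f 0 = z * g z * (1 - cnj (f 0) * f z)"
proof (cases "norm (f 0) = 1")
  case True
  have eq: "f z = f 0" if "z \<in> ball 0 1" for z
    by (rule schur_class_const[OF f]) (use True that in auto)
  show ?thesis
  proof (intro bexI ballI)
    show "f z - f 0 = z * 0 * (1 - cnj (f 0) * f z)" if "z \<in> ball 0 1" for z
      using eq[OF that] by simp
  qed (simp add: schur_class_def)
next
  case False
  have holf: "f holomorphic_on ball 0 1" and le: "\<And>z. z \<in> ball 0 1 \<Longrightarrow> norm (f z) \<le> 1"
    using f by (auto simp: schur_class_def)
  with False have less: "norm (f 0) < 1" by (force simp: less_le)
  have nz: "1 - cnj (f 0) * f z \<noteq> 0" if "z \<in> ball 0 1" for z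
  proof
    assume "1 - cnj (f 0) * f z = 0"
    then have "norm (cnj (f 0) * f z) = 1" by simp
    moreover have "norm (cnj (f 0) * f z) \<le> norm (f 0) * 1"
      unfolding norm_mult complex_mod_cnj using le[OF that] by (intro mult_left_mono) auto
    ultimately show False using less by simp
  qed
  define m where "m z = (f z - f 0) / (1 - cnj (f 0) * f z)" for z
  have "m holomorphic_on ball 0 1"
    unfolding m_def using nz by (intro holomorphic_intros holf) auto
  moreover have "norm (m z) \<le> 1" if "z \<in> ball 0 1" for z
    using norm_moebius_le_1[of "f 0" "f z"] le[OF that] less nz[OF that]
    by (simp add: m_def norm_divide)
  ultimately have "m \<in> schur_class" by (simp add: schur_class_def)
  moreover have "m 0 = 0" by (simp add: m_def)
  ultimately obtain g where "g \<in> schur_class" "\<And>z. z \<in> ball 0 1 \<Longrightarrow> m z = z * g z"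
    using schur_class_factor by blast
  then show ?thesis using nz by (force simp: m_def divide_eq_eq)
qed

section \<open>Taylor coefficients of Schur functions\<close>

lemma has_fps_expansion_ball:
  assumes "f holomorphic_on ball 0 r" "0 < r"
  shows "f has_fps_expansion fps_expansion f 0"
  by (rule has_fps_expansion_fps_expansion[of "ball 0 r"]) (use assms in auto)

lemma fps_eq_of_eq_on_ball:
  fixes f g :: "complex \<Rightarrow> complex"
  assumes "f has_fps_expansion F" "g has_fps_expansion G" "0 < r"
    and "\<And>z. z \<in> ball 0 r \<Longrightarrow> f z = g z"
  shows "F = G"
proof -
  have "eventually (\<lambda>z. z \<in> ball 0 r) (nhds (0::complex))"
    using \<open>0 < r\<close> by (intro eventually_nhds_in_open) auto
  then have "eventually (\<lambda>z. f z = g z) (nhds 0)"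
    by eventually_elim (use assms in auto)
  then have "f has_fps_expansion G"
    using assms(2) has_fps_expansion_cong by blast
  then show ?thesis using assms(1) fps_expansion_unique_complex by blast
qed

lemma fps_nth_0_fps_expansion [simp]: "fps_nth (fps_expansion f 0) 0 = f 0"
  by (simp add: fps_expansion_def)

lemma schur_class_fps_step:
  assumes f: "f \<in> schur_class"
  defines "\<Psi> \<equiv> fps_expansion f 0"
  shows "\<exists>g \<in> schur_class. \<Psi> - fps_const (f 0) = fps_X * fps_expansion g 0 * (1 - fps_const (cnj (f 0)) * \<Psi>)"
proof -
  obtain g where g: "g \<in> schur_class"
    "\<And>z. z \<in> ball 0 1 \<Longrightarrow> f z - f 0 = z * g z * (1 - cnj (f 0) * f z)"
    using schur_class_step[OF f] by blast
  have F: "f has_fps_expansion \<Psi>" and G: "g has_fps_expansion fps_expansion g 0"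
    using f g has_fps_expansion_ball[of _ 1] by (auto simp: schur_class_def \<Psi>_def)
  have "\<Psi> - fps_const (f 0) = fps_X * fps_expansion g 0 * (1 - fps_const (cnj (f 0)) * \<Psi>)"
  proof (rule fps_eq_of_eq_on_ball)
    show "(\<lambda>z. f z - f 0) has_fps_expansion \<Psi> - fps_const (f 0)"
      by (intro fps_expansion_intros F)
    show "(\<lambda>z. z * g z * (1 - cnj (f 0) * f z)) has_fps_expansion
        fps_X * fps_expansion g 0 * (1 - fps_const (cnj (f 0)) * \<Psi>)"
      by (intro fps_expansion_intros F G)
  qed (use g(2) in auto)
  then show ?thesis using g(1) by blast
qed

text \<open>Schwarz-Pick at the origin: the Schur step gives the coefficient as \<open>g 0\<close>
  times \<open>1 - (norm (f 0))^2\<close>.\<close>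

lemma schur_class_coeff_1:
  assumes f: "f \<in> schur_class"
  shows "norm (fps_nth (fps_expansion f 0) 1) \<le> 1 - (norm (f 0))\<^sup>2"
proof -
  obtain g where g: "g \<in> schur_class" and
    eq: "fps_expansion f 0 - fps_const (f 0) =
      fps_X * fps_expansion g 0 * (1 - fps_const (cnj (f 0)) * fps_expansion f 0)"
    using schur_class_fps_step[OF f] by blast
  have le: "norm (g 0) \<le> 1" "norm (f 0) \<le> 1" using f g by (auto simp: schur_class_def)
  have "fps_nth (fps_expansion f 0) 1 = g 0 * (1 - cnj (f 0) * f 0)"
    using arg_cong[OF eq, of "\<lambda>F. fps_nth F 1"] by (simp add: fps_mult_nth)
  also have "1 - cnj (f 0) * f 0 = of_real (1 - (norm (f 0))\<^sup>2)"
    by (simp only: of_real_diff complex_norm_square) simp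
  finally have "norm (fps_nth (fps_expansion f 0) 1) = norm (g 0) * (1 - (norm (f 0))\<^sup>2)"
    using le by (simp add: norm_mult power_le_one del: of_real_diff of_real_power)
  then show ?thesis using le by (simp add: mult_left_le_one_le power_le_one)
qed

text \<open>Here \<open>x\<close> and \<open>y\<close> are the value and the derivative at 0 of the
  function \<open>g\<close> from the first Schur step; the bound on \<open>y\<close> is the
  first-coefficient estimate for \<open>g\<close>.\<close>

lemma schur_class_coeffs:
  assumes f: "f \<in> schur_class"
  obtains x y where "norm x \<le> 1" "norm y \<le> 1 - (norm x)\<^sup>2"
    "fps_nth (fps_expansion f 0) 1 = (1 - f 0 * cnj (f 0)) * x"
    "fps_nth (fps_expansion f 0) 2 = (1 - f 0 * cnj (f 0)) * (y - cnj (f 0) * x\<^sup>2)"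
proof -
  obtain g where g: "g \<in> schur_class" and
    eq: "fps_expansion f 0 - fps_const (f 0) =
      fps_X * fps_expansion g 0 * (1 - fps_const (cnj (f 0)) * fps_expansion f 0)"
    using schur_class_fps_step[OF f] by blast
  have c: "fps_nth (fps_expansion f 0) 1 = (1 - f 0 * cnj (f 0)) * g 0"
    "fps_nth (fps_expansion f 0) 2 =
      fps_nth (fps_expansion g 0) 1 * (1 - f 0 * cnj (f 0)) - g 0 * cnj (f 0) * fps_nth (fps_expansion f 0) 1"
    using arg_cong[OF eq, of "\<lambda>F. fps_nth F 1"] arg_cong[OF eq, of "\<lambda>F. fps_nth F 2"]
    by (simp_all add: fps_mult_nth numeral_eq_Suc algebra_simps)
  show thesis
  proof (rule that)
    show "norm (g 0) \<le> 1" using g by (auto simp: schur_class_def)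
    show "norm (fps_nth (fps_expansion g 0) 1) \<le> 1 - (norm (g 0))\<^sup>2" by (rule schur_class_coeff_1[OF g])
    show "fps_nth (fps_expansion f 0) 1 = (1 - f 0 * cnj (f 0)) * g 0" by (rule c(1))
    show "fps_nth (fps_expansion f 0) 2 =
        (1 - f 0 * cnj (f 0)) * (fps_nth (fps_expansion g 0) 1 - cnj (f 0) * (g 0)\<^sup>2)"
      unfolding c(2) c(1) by (simp add: power2_eq_square algebra_simps)
  qed
qed

section \<open>The inverse of a convex function\<close>

lemma class_C_D:
  assumes "f \<in> class_C"
  shows "f holomorphic_on ball 0 1" "f 0 = 0" "deriv f 0 = 1" "inj_on f (ball 0 1)" "convex (f ` ball 0 1)"
  using assms by (auto simp: class_C_def class_S_def class_A_def)

text \<open>A half-plane \<open>Re (e w) < 1/4\<close> containing the image would make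
  \<open>e f / (1/2 - e f)\<close> a self-map of the disc with derivative of modulus 2 at the origin.\<close>

lemma class_C_covers:
  assumes f: "f \<in> class_C"
  shows "ball 0 (1 / 4) \<subseteq> f ` ball 0 1"
proof
  note C = class_C_D[OF f]
  fix w :: complex assume w: "w \<in> ball 0 (1 / 4)"
  show "w \<in> f ` ball 0 1"
  proof (rule ccontr)
    assume "w \<notin> f ` ball 0 1"
    then have "f ` ball 0 1 \<inter> {w} = {}" by blast
    then obtain a b where ab: "a \<noteq> 0" "\<And>x. x \<in> f ` ball 0 1 \<Longrightarrow> inner a x \<le> b" "inner a w \<ge> b"
      using separating_hyperplane_sets[OF C(5), of "{w}"] by auto
    \<comment> \<open>Multiplication by \<open>e\<close> turns the separating line into a vertical
      one.\<close>
    define e where "e = cnj a / norm a"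
    have ne: "norm e = 1" using ab(1) by (simp add: e_def norm_divide)
    have Re_e: "Re (e * x) = inner a x / norm a" for x
      by (simp add: e_def inner_complex_def)
    have Re_less: "Re (e * f z) < 1 / 4" if "z \<in> ball 0 1" for z
    proof -
      have "Re (e * f z) \<le> Re (e * w)"
        unfolding Re_e using ab(2)[of "f z"] ab(3) that by (intro divide_right_mono) auto
      also have "\<dots> \<le> norm (e * w)" by (rule complex_Re_le_cmod)
      also have "\<dots> < 1 / 4" using w by (simp add: norm_mult ne)
      finally show ?thesis .
    qed
    define G where "G z = e * f z / (1 / 2 - e * f z)" for z
    have nz: "1 / 2 - e * f z \<noteq> 0" if "z \<in> ball 0 1" for z
    proof
      assume "1 / 2 - e * f z = 0"
      then have "e * f z = of_real (1 / 2)" by simp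
      then have "Re (e * f z) = 1 / 2" by (simp only: Re_complex_of_real)
      then show False using Re_less[OF that] by simp
    qed
    have "norm (deriv G 0) \<le> 1"
    proof (rule Schwarz_Lemma(2))
      show "G holomorphic_on ball 0 1"
        unfolding G_def using nz by (intro holomorphic_intros C(1)) auto
      show "G 0 = 0" by (simp add: G_def C(2))
      show "norm (G z) < 1" if "norm z < 1" for z
      proof -
        \<comment> \<open>\<open>Re u < 1/4\<close> means that \<open>u\<close> is closer to
          \<open>0\<close> than to \<open>1/2\<close>.\<close>
        have "(norm (e * f z))\<^sup>2 < (norm (1 / 2 - e * f z))\<^sup>2"
          using Re_less[of z] that unfolding cmod_power2
          by (simp add: power2_eq_square algebra_simps)
        then have "norm (e * f z) < norm (1 / 2 - e * f z)"
          by (rule power2_less_imp_less) simp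
        then show ?thesis unfolding G_def norm_divide by (subst divide_less_eq_1) auto
      qed
      show "norm (0 :: complex) < 1" by simp
    qed
    moreover have "(f has_field_derivative 1) (at 0)"
      using holomorphic_derivI[OF C(1) open_ball, of 0] C(3) by simp
    then have "(G has_field_derivative 2 * e) (at 0)"
      unfolding G_def by (auto intro!: derivative_eq_intros simp: C(2))
    then have "deriv G 0 = 2 * e" by (rule DERIV_imp_deriv)
    ultimately show False by (simp add: norm_mult ne)
  qed
qed

text \<open>On the image, \<open>disc_inverse f\<close> coincides with the holomorphic inverse of
  \<open>f\<close>; as the image is open, the derivatives coincide there as well.\<close>

lemma class_C_inverse:
  assumes f: "f \<in> class_C"
  shows "disc_inverse f holomorphic_on f ` ball 0 1"
    and "\<And>z. z \<in> ball 0 1 \<Longrightarrow> disc_inverse f (f z) = z"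
    and "\<And>z. z \<in> ball 0 1 \<Longrightarrow> deriv f z * deriv (disc_inverse f) (f z) = 1"
    and "open (f ` ball 0 1)"
proof -
  note C = class_C_D[OF f]
  show op: "open (f ` ball 0 1)"
    by (rule open_mapping_thm3[OF C(1) open_ball C(4)])
  obtain g where g: "g holomorphic_on f ` ball 0 1"
    "\<And>z. z \<in> ball 0 1 \<Longrightarrow> deriv f z * deriv g (f z) = 1" "\<And>z. z \<in> ball 0 1 \<Longrightarrow> g (f z) = z"
    using holomorphic_has_inverse[OF C(1) open_ball C(4)] by metis
  show inv: "disc_inverse f (f z) = z" if "z \<in> ball 0 1" for z
    unfolding disc_inverse_def by (rule inv_into_f_f[OF C(4) that])
  then have eq: "disc_inverse f w = g w" if "w \<in> f ` ball 0 1" for w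
    using that g(3) by auto
  then show "disc_inverse f holomorphic_on f ` ball 0 1"
    using g(1) holomorphic_cong by blast
  show "deriv f z * deriv (disc_inverse f) (f z) = 1" if z: "z \<in> ball 0 1" for z
  proof -
    have "eventually (\<lambda>w. w \<in> f ` ball 0 1) (nhds (f z))"
      using op z by (intro eventually_nhds_in_open) auto
    then have "eventually (\<lambda>w. disc_inverse f w = g w) (nhds (f z))"
      by eventually_elim (rule eq)
    then have "deriv (disc_inverse f) (f z) = deriv g (f z)"
      by (rule deriv_cong_ev) simp
    then show ?thesis using g(2)[OF z] by simp
  qed
qed

text \<open>The choice defining \<open>log_inverse\<close> is not vacuous:
  \<open>f^-1(w) / w\<close> extends to a zero-free function with value 1 at 0, which has a
  holomorphic logarithm on the disc; subtracting its value at 0 fixes the branch.\<close>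

lemma class_C_log_inverse:
  assumes f: "f \<in> class_C"
  shows "is_log_quotient (disc_inverse f) (log_inverse f)"
proof -
  note C = class_C_D[OF f] and I = class_C_inverse[OF f] and cov = class_C_covers[OF f]
  have hol: "disc_inverse f holomorphic_on ball 0 (1 / 4)"
    using I(1) cov holomorphic_on_subset by blast
  have z0: "disc_inverse f 0 = 0" using I(2)[of 0] C(2) by simp
  have d0: "deriv (disc_inverse f) 0 = 1" using I(3)[of 0] C(2,3) by simp
  obtain h where h: "h holomorphic_on ball 0 (1 / 4)"
    "\<And>w. norm w < 1 / 4 \<Longrightarrow> disc_inverse f w = w * h w" "deriv (disc_inverse f) 0 = h 0"
    using Schwarz3[OF hol z0] by metis
  have h0: "h 0 = 1" using h(3) d0 by simp
  have nz: "h w \<noteq> 0" if w: "w \<in> ball 0 (1 / 4)" for w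
  proof
    assume "h w = 0"
    then have "disc_inverse f w = 0" using h(2) w by simp
    moreover obtain z where "z \<in> ball 0 1" "w = f z" using cov w by blast
    ultimately have "w = 0" using I(2) C(2) by auto
    then show False using h0 \<open>h w = 0\<close> by simp
  qed
  obtain L where L: "L holomorphic_on ball 0 (1 / 4)" "\<And>w. w \<in> ball 0 (1 / 4) \<Longrightarrow> exp (L w) = h w"
    using holomorphic_logarithm_exists[of "ball 0 (1 / 4)" h 0] h(1) nz by auto
  have "exp (L 0) = 1" using L(2)[of 0] h0 by simp
  then have "is_log_quotient (disc_inverse f) (\<lambda>w. L w - L 0)"
    unfolding is_log_quotient_def using L h(2) by (auto intro!: holomorphic_intros simp: exp_diff)
  then show ?thesis unfolding log_inverse_def by (metis someI)
qed

text \<open>For \<open>|w| < 1/4\<close>, \<open>w exp (F w) = f^-1(w)\<close>; applying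
  \<open>f\<close> gives the hypothesis of the formal lemma. The halving in
  \<open>log_inverse_coeff\<close> supplies the factor 1/4 that turns 12 into 48.\<close>

lemma class_C_hankel:
  assumes f: "f \<in> class_C"
  defines "A \<equiv> fps_expansion f 0"
  shows "hankel_2_1 (log_inverse_coeff f) =
    (13 * fps_nth A 2 ^ 4 - 12 * (fps_nth A 2)\<^sup>2 * fps_nth A 3 - 12 * (fps_nth A 3)\<^sup>2
      + 12 * fps_nth A 2 * fps_nth A 4) / 48"
proof -
  note C = class_C_D[OF f] and cov = class_C_covers[OF f]
  define F where "F = log_inverse f"
  define \<Phi> where "\<Phi> = fps_expansion F 0"
  have F: "F holomorphic_on ball 0 (1 / 4)" "F 0 = 0"
    "\<And>w. w \<in> ball 0 (1 / 4) - {0} \<Longrightarrow> exp (F w) = disc_inverse f w / w"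
    using class_C_log_inverse[OF f] by (auto simp: F_def is_log_quotient_def)
  have A0: "fps_nth A 0 = 0" and A1: "fps_nth A 1 = 1" and \<Phi>0: "fps_nth \<Phi> 0 = 0"
    using C(2,3) F(2) by (simp_all add: A_def \<Phi>_def fps_expansion_def)
  have eA: "f has_fps_expansion A" unfolding A_def using has_fps_expansion_ball[OF C(1)] by simp
  have e\<Phi>: "F has_fps_expansion \<Phi>" unfolding \<Phi>_def using has_fps_expansion_ball[OF F(1)] by simp
  have eexp: "(exp \<circ> F) has_fps_expansion (fps_exp 1 oo \<Phi>)"
    by (rule has_fps_expansion_compose[OF _ e\<Phi> \<Phi>0]) (use has_fps_expansion_exp[of 1] in simp)
  have "(f \<circ> (\<lambda>w. w * (exp \<circ> F) w)) has_fps_expansion (A oo (fps_X * (fps_exp 1 oo \<Phi>)))"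
    by (intro has_fps_expansion_compose eA fps_expansion_intros eexp) simp
  moreover have "(\<lambda>w. w) has_fps_expansion fps_X" by (rule fps_expansion_intros)
  ultimately have "A oo (fps_X * (fps_exp 1 oo \<Phi>)) = fps_X"
  proof (rule fps_eq_of_eq_on_ball)
    fix w :: complex assume w: "w \<in> ball 0 (1 / 4)"
    show "(f \<circ> (\<lambda>w. w * (exp \<circ> F) w)) w = w"
    proof (cases "w = 0")
      case True
      then show ?thesis using C(2) by simp
    next
      case False
      then have "w * exp (F w) = disc_inverse f w" using F(3)[of w] w by simp
      then show ?thesis using cov w unfolding disc_inverse_def by (auto simp: f_inv_into_f)
    qed
  qed simp
  note fps_log_inverse_hankel[OF A0 A1 \<Phi>0 this]
  moreover have "hankel_2_1 (log_inverse_coeff f) =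
      (fps_nth \<Phi> 1 * fps_nth \<Phi> 3 - (fps_nth \<Phi> 2)\<^sup>2) / 4"
    by (simp add: hankel_2_1_def log_inverse_coeff_def \<Phi>_def F_def power_divide diff_divide_distrib)
  ultimately show ?thesis by (simp only: divide_divide_eq_left) simp
qed

section \<open>Convex functions and Schur functions\<close>

lemma class_C_deriv_nonzero:
  assumes "f \<in> class_C" "z \<in> ball 0 1"
  shows "deriv f z \<noteq> 0"
  using class_C_inverse(3)[OF assms] by auto

text \<open>With \<open>u\<close> and \<open>v\<close> fixed,
  \<open>x \<mapsto> f^-1 ((f (x u) + f (x v)) / 2)\<close> is, by convexity, a self-map of the disc
  fixing 0, so the Schwarz lemma applies.\<close>

lemma class_C_midpoint_schwarz:
  assumes f: "f \<in> class_C" and z: "z \<in> ball 0 1" and uv: "norm u = 1" "norm v = 1"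
  shows "(f (z * u) + f (z * v)) / 2 \<in> f ` ball 0 1"
    and "norm (disc_inverse f ((f (z * u) + f (z * v)) / 2)) \<le> norm z"
proof -
  note C = class_C_D[OF f] and I = class_C_inverse[OF f]
  have rot: "x * u \<in> ball 0 1" "x * v \<in> ball 0 1" if "x \<in> ball 0 1" for x
    using that uv by (auto simp: norm_mult)
  have mid: "(f (x * u) + f (x * v)) / 2 \<in> f ` ball 0 1" if "x \<in> ball 0 1" for x
    using convexD[OF C(5), of "f (x * u)" "f (x * v)" "1 / 2" "1 / 2"] rot[OF that]
    by (simp add: scaleR_conv_of_real add_divide_distrib)
  then show "(f (z * u) + f (z * v)) / 2 \<in> f ` ball 0 1" using z by blast
  define m where "m x = disc_inverse f ((f (x * u) + f (x * v)) / 2)" for x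
  have "norm (m z) \<le> norm z"
  proof (rule Schwarz_Lemma(1))
    have "(\<lambda>x. (f (x * u) + f (x * v)) / 2) holomorphic_on ball 0 1"
      by (intro holomorphic_intros holomorphic_on_compose_gen[OF _ C(1), unfolded o_def])
        (use rot in auto)
    then show "m holomorphic_on ball 0 1"
      unfolding m_def
      by (rule holomorphic_on_compose_gen[OF _ I(1), unfolded o_def]) (use mid in auto)
    show "m 0 = 0" using I(2)[of 0] C(2) by (simp add: m_def)
    show "norm (m x) < 1" if "norm x < 1" for x
      using mid[of x] I(2) that by (auto simp: m_def)
  qed (use z in auto)
  then show "norm (disc_inverse f ((f (z * u) + f (z * v)) / 2)) \<le> norm z" by (simp add: m_def)
qed

text \<open>If \<open>D > 0\<close>, then \<open>u'\<close> is positive just to the right of 0, and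
  the mean value theorem gives a larger value of \<open>u\<close> there.\<close>

lemma second_derivative_nonpos_at_max:
  fixes u u' :: "real \<Rightarrow> real"
  assumes u: "\<And>t. (u has_real_derivative u' t) (at t)" and u': "(u' has_real_derivative D) (at 0)"
    and "u' 0 = 0" and max: "\<And>t. u t \<le> u 0"
  shows "D \<le> 0"
proof (rule ccontr)
  assume "\<not> D \<le> 0"
  then obtain d where d: "0 < d" "\<And>h. 0 < h \<Longrightarrow> h < d \<Longrightarrow> u' 0 < u' (0 + h)"
    using DERIV_pos_inc_right[OF u'] by auto
  obtain t where "0 < t" "t < d / 2" "u (d / 2) - u 0 = (d / 2 - 0) * u' t"
    using MVT2[of 0 "d / 2" u u'] u \<open>0 < d\<close> by auto
  moreover from this have "0 < u' t" using d(2)[of t] \<open>u' 0 = 0\<close> by simp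
  then have "0 < (d / 2 - 0) * u' t" using \<open>0 < d\<close> by simp
  ultimately have "0 < u (d / 2) - u 0" by linarith
  then show False using max[of "d / 2"] by simp
qed

text \<open>\<open>Re (cnj z * g (q t))\<close> takes the place of the modulus of
  \<open>g (q t)\<close>: it is at most \<open>|z|^2\<close> for real \<open>t\<close>, with
  equality at \<open>t = 0\<close>, and is easy to differentiate twice.\<close>

lemma class_C_Re_nonneg:
  assumes f: "f \<in> class_C" and z: "z \<in> ball 0 1"
  shows "0 \<le> Re (1 + z * deriv (deriv f) z / deriv f z)"
proof (cases "z = 0")
  case True
  then show ?thesis by simp
next
  case False
  note C = class_C_D[OF f] and I = class_C_inverse[OF f]
  define g where "g = disc_inverse f"
  \<comment> \<open>The parameter is complex so that complex differentiation rules apply; the points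
    lie in the disc for real parameters, and \<open>q\<close> is differentiated only there.\<close>
  define a where "a s = z * exp (\<i> * s)" for s
  define b where "b s = z * exp (- (\<i> * s))" for s
  define q where "q s = (f (a s) + f (b s)) / 2" for s
  define q' where "q' s = \<i> * (a s * deriv f (a s) - b s * deriv f (b s)) / 2" for s
  have a: "(a has_field_derivative \<i> * a s) (at s)" and b: "(b has_field_derivative - (\<i> * b s)) (at s)" for s
    unfolding a_def b_def by (auto intro!: derivative_eq_intros)
  have ab0: "a 0 = z" "b 0 = z" by (simp_all add: a_def b_def)
  have nab: "a (of_real t) \<in> ball 0 1" "b (of_real t) \<in> ball 0 1" for t
    using z by (simp_all add: a_def b_def norm_mult exp_minus norm_inverse)
  have df: "(f has_field_derivative deriv f w) (at w)" if "w \<in> ball 0 1" for w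
    using holomorphic_derivI[OF C(1) open_ball that] .
  have hol': "deriv f holomorphic_on ball 0 1"
    using holomorphic_deriv[OF C(1) open_ball] .
  have ddf: "(deriv f has_field_derivative deriv (deriv f) w) (at w)" if "w \<in> ball 0 1" for w
    using holomorphic_derivI[OF hol' open_ball that] .
  have dq: "(q has_field_derivative q' (of_real t)) (at (of_real t))" for t
    unfolding q_def q'_def
    by (rule derivative_eq_intros DERIV_chain2[OF df[OF nab(1)] a] DERIV_chain2[OF df[OF nab(2)] b] refl)+
      (simp_all add: field_simps)
  have "((\<lambda>s. a s * deriv f (a s)) has_field_derivative
      \<i> * a 0 * deriv f (a 0) + deriv (deriv f) (a 0) * (\<i> * a 0) * a 0) (at 0)"
    by (rule DERIV_mult[OF a DERIV_chain2[OF ddf a]]) (use nab(1)[of 0] in simp)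
  moreover have "((\<lambda>s. b s * deriv f (b s)) has_field_derivative
      - (\<i> * b 0) * deriv f (b 0) + deriv (deriv f) (b 0) * (- (\<i> * b 0)) * b 0) (at 0)"
    by (rule DERIV_mult[OF b DERIV_chain2[OF ddf b]]) (use nab(2)[of 0] in simp)
  ultimately have dq': "(q' has_field_derivative - z * (deriv f z + z * deriv (deriv f) z)) (at 0)"
    unfolding q'_def
    by (intro DERIV_cong[OF DERIV_cdivide[OF DERIV_cmult[OF DERIV_diff]]]) (auto simp: ab0 field_simps)
  have q0: "q 0 = f z" "q' 0 = 0" by (simp_all add: q_def q'_def ab0)
  have n1: "norm (exp (\<i> * of_real t)) = 1" "norm (exp (- (\<i> * of_real t))) = 1" for t
    by (simp_all add: exp_minus norm_inverse)
  have qin: "q (of_real t) \<in> f ` ball 0 1" and gq: "norm (g (q (of_real t))) \<le> norm z" for t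
    using class_C_midpoint_schwarz[OF f z n1[of t]] by (simp_all add: q_def a_def b_def g_def)
  have dg: "(g has_field_derivative deriv g w) (at w)" if "w \<in> f ` ball 0 1" for w
    unfolding g_def using holomorphic_derivI[OF I(1) I(4) that] .
  have ddg: "(deriv g has_field_derivative deriv (deriv g) w) (at w)" if "w \<in> f ` ball 0 1" for w
    using holomorphic_derivI[OF holomorphic_deriv[OF I(1) I(4)] I(4) that] by (simp add: g_def)
  define P' where "P' s = deriv g (q s) * q' s" for s
  have dP: "((\<lambda>s. cnj z * g (q s)) has_field_derivative cnj z * P' (of_real t)) (at (of_real t))" for t
    unfolding P'_def by (intro DERIV_cmult DERIV_chain2[OF dg[OF qin] dq])
  have q0in: "q 0 \<in> f ` ball 0 1" using q0 z by simp
  \<comment> \<open>Since \<open>q' 0 = 0\<close>, the second derivative of \<open>g\<close> drops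
    out of the result.\<close>
  have "((\<lambda>s. deriv g (q s)) has_field_derivative deriv (deriv g) (q 0) * q' 0) (at 0)"
    by (rule DERIV_chain2[where f = "deriv g" and g = q and x = 0]) (use ddg[OF q0in] dq[of 0] in simp_all)
  note DERIV_cmult[OF DERIV_mult[OF this dq'], of "cnj z"]
  moreover have "deriv f z * deriv g (q 0) = 1" using I(3)[OF z] by (simp add: g_def q0)
  then have "deriv g (q 0) = 1 / deriv f z" using class_C_deriv_nonzero[OF f z] by (simp add: field_simps)
  ultimately have dP': "((\<lambda>s. cnj z * P' s) has_field_derivative
      cnj z * (- z * (1 + z * deriv (deriv f) z / deriv f z))) (at 0)"
    unfolding P'_def
    by (elim DERIV_cong) (use class_C_deriv_nonzero[OF f z] in \<open>simp add: q0 field_simps\<close>)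
  have "Re (cnj z * (- z * (1 + z * deriv (deriv f) z / deriv f z))) \<le> 0"
  proof (rule second_derivative_nonpos_at_max)
    show "((\<lambda>t. Re (cnj z * g (q (of_real t)))) has_real_derivative Re (cnj z * P' (of_real t))) (at t)" for t
      by (intro has_field_derivative_Re has_vector_derivative_real_field dP)
    show "((\<lambda>t. Re (cnj z * P' (of_real t))) has_real_derivative
        Re (cnj z * (- z * (1 + z * deriv (deriv f) z / deriv f z)))) (at 0)"
      by (intro has_field_derivative_Re has_vector_derivative_real_field) (use dP' in simp)
    show "Re (cnj z * P' (of_real 0)) = 0" by (simp add: P'_def q0)
    show "Re (cnj z * g (q (of_real t))) \<le> Re (cnj z * g (q (of_real 0)))" for t
    proof -
      have "Re (cnj z * g (q (of_real t))) \<le> norm (cnj z * g (q (of_real t)))" by (rule complex_Re_le_cmod)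
      also have "\<dots> \<le> norm z * norm z" unfolding norm_mult using gq[of t] by (simp add: mult_left_mono)
      also have "\<dots> = Re (cnj z * g (q (of_real 0)))"
        using I(2)[OF z] by (simp add: q0 g_def cmod_power2 flip: power2_eq_square)
      finally show ?thesis .
    qed
  qed
  moreover have "Re (cnj z * (- z * p)) = - ((norm z)\<^sup>2 * Re p)" for p
    unfolding cmod_power2 by (simp add: power2_eq_square algebra_simps)
  ultimately have "0 \<le> (norm z)\<^sup>2 * Re (1 + z * deriv (deriv f) z / deriv f z)"
    by (simp only: neg_le_0_iff_le)
  then show ?thesis using False by (simp add: zero_le_mult_iff)
qed

text \<open>A point of the closed right half-plane is at least as close to 1 as to -1.\<close>

lemma norm_Cayley_le_1:
  assumes "0 \<le> Re p"
  shows "norm (p - 1) \<le> norm (p + 1)" and "p + 1 \<noteq> 0"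
proof -
  have "(norm (p - 1))\<^sup>2 \<le> (norm (p + 1))\<^sup>2"
    using assms unfolding cmod_power2 by (simp add: power2_eq_square algebra_simps)
  then show "norm (p - 1) \<le> norm (p + 1)" by (rule power2_le_imp_le) simp
  show "p + 1 \<noteq> 0"
  proof
    assume "p + 1 = 0"
    then have "Re (p + 1) = 0" by simp
    then show False using assms by simp
  qed
qed

text \<open>With \<open>p = 1 + z f'' / f'\<close>, the quotient
  \<open>(p - 1) / (p + 1) = z f'' / (2 f' + z f'')\<close> is a Schur function vanishing at 0,
  hence of the form \<open>z \<psi>\<close>. The common factor \<open>z\<close> stays in the
  statement and is cancelled later among power series.\<close>

lemma class_C_schur:
  assumes f: "f \<in> class_C"
  shows "\<exists>\<psi> \<in> schur_class. \<forall>z \<in> ball 0 1.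
    z * deriv (deriv f) z = z * \<psi> z * (2 * deriv f z + z * deriv (deriv f) z)"
proof -
  note C = class_C_D[OF f]
  define p where "p z = 1 + z * deriv (deriv f) z / deriv f z" for z
  have hol': "deriv f holomorphic_on ball 0 1" "deriv (deriv f) holomorphic_on ball 0 1"
    using C(1) by (auto intro!: holomorphic_deriv)
  have p: "p z + 1 \<noteq> 0" "norm (p z - 1) \<le> norm (p z + 1)" if "z \<in> ball 0 1" for z
    using norm_Cayley_le_1[OF class_C_Re_nonneg[OF f that]] by (simp_all add: p_def)
  have nz: "deriv f z \<noteq> 0" if "z \<in> ball 0 1" for z
    using class_C_deriv_nonzero[OF f that] .
  define \<omega> where "\<omega> z = (p z - 1) / (p z + 1)" for z
  have "p holomorphic_on ball 0 1"
    unfolding p_def using nz by (intro holomorphic_intros hol') auto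
  then have "\<omega> holomorphic_on ball 0 1"
    unfolding \<omega>_def using p(1) by (intro holomorphic_intros) auto
  moreover have "norm (\<omega> z) \<le> 1" if "z \<in> ball 0 1" for z
    using p[OF that] by (simp add: \<omega>_def norm_divide)
  ultimately have "\<omega> \<in> schur_class" by (simp add: schur_class_def)
  moreover have "\<omega> 0 = 0" by (simp add: \<omega>_def p_def)
  ultimately obtain \<psi> where \<psi>: "\<psi> \<in> schur_class" "\<And>z. z \<in> ball 0 1 \<Longrightarrow> \<omega> z = z * \<psi> z"
    using schur_class_factor by blast
  have "z * deriv (deriv f) z = z * \<psi> z * (2 * deriv f z + z * deriv (deriv f) z)"
    if z: "z \<in> ball 0 1" for z
  proof -
    have "p z - 1 = z * \<psi> z * (p z + 1)"
      using \<psi>(2)[OF z] p(1)[OF z] by (simp add: \<omega>_def divide_eq_eq)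
    moreover have "z * deriv (deriv f) z = deriv f z * (p z - 1)"
      using nz[OF z] by (simp add: p_def)
    moreover have "2 * deriv f z + z * deriv (deriv f) z = deriv f z * (p z + 1)"
      using nz[OF z] by (simp add: p_def algebra_simps)
    ultimately show ?thesis by (simp only: mult_ac)
  qed
  then show ?thesis using \<psi>(1) by blast
qed

lemma class_C_hankel_bound:
  assumes f: "f \<in> class_C"
  shows "norm (hankel_2_1 (log_inverse_coeff f)) \<le> 1 / 33"
proof -
  note C = class_C_D[OF f]
  define A where "A = fps_expansion f 0"
  obtain \<psi> where \<psi>: "\<psi> \<in> schur_class"
    "\<And>z. z \<in> ball 0 1 \<Longrightarrow> z * deriv (deriv f) z = z * \<psi> z * (2 * deriv f z + z * deriv (deriv f) z)"
    using class_C_schur[OF f] by blast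
  define \<Psi> where "\<Psi> = fps_expansion \<psi> 0"
  define w where "w = \<psi> 0"
  have eA: "f has_fps_expansion A" unfolding A_def using has_fps_expansion_ball[OF C(1)] by simp
  have e\<Psi>: "\<psi> has_fps_expansion \<Psi>"
    unfolding \<Psi>_def using has_fps_expansion_ball[of \<psi> 1] \<psi>(1) by (simp add: schur_class_def)
  note eA' = has_fps_expansion_deriv[OF eA]
  note eA'' = has_fps_expansion_deriv[OF eA']
  have "fps_X * fps_deriv (fps_deriv A) =
      fps_X * \<Psi> * (2 * fps_deriv A + fps_X * fps_deriv (fps_deriv A))"
  proof (rule fps_eq_of_eq_on_ball)
    show "(\<lambda>z. z * deriv (deriv f) z) has_fps_expansion fps_X * fps_deriv (fps_deriv A)"
      by (intro fps_expansion_intros eA'')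
    show "(\<lambda>z. z * \<psi> z * (2 * deriv f z + z * deriv (deriv f) z)) has_fps_expansion
        fps_X * \<Psi> * (2 * fps_deriv A + fps_X * fps_deriv (fps_deriv A))"
      by (intro fps_expansion_intros eA' eA'' e\<Psi>)
  qed (use \<psi>(2) in auto)
  then have "fps_X * fps_deriv (fps_deriv A) =
      fps_X * (\<Psi> * (2 * fps_deriv A + fps_X * fps_deriv (fps_deriv A)))"
    by (simp only: mult.assoc)
  then have ode: "fps_deriv (fps_deriv A) = \<Psi> * (2 * fps_deriv A + fps_X * fps_deriv (fps_deriv A))"
    by (simp only: mult_cancel_left) simp
  have A1: "fps_nth A 1 = 1" using C(3) by (simp add: A_def fps_expansion_def)
  have \<Psi>0: "fps_nth \<Psi> 0 = w" by (simp add: \<Psi>_def w_def)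
  obtain x y where xy: "norm x \<le> 1" "norm y \<le> 1 - (norm x)\<^sup>2"
    and \<Psi>1: "fps_nth \<Psi> 1 = (1 - w * cnj w) * x"
    and \<Psi>2: "fps_nth \<Psi> 2 = (1 - w * cnj w) * (y - cnj w * x\<^sup>2)"
    using schur_class_coeffs[OF \<psi>(1)] unfolding \<Psi>_def w_def by metis
  \<comment> \<open>\<open>B\<close> is 144 times the determinant, and \<open>48/11\<close> divided
    by 144 is \<open>1/33\<close>.\<close>
  define B where "B = 3 * w ^ 4 - 6 * w\<^sup>2 * ((1 - w * cnj w) * x) - 4 * ((1 - w * cnj w) * x)\<^sup>2
    + 6 * w * ((1 - w * cnj w) * (y - cnj w * x\<^sup>2))"
  have a: "fps_nth A 2 = w" "fps_nth A 3 = fps_nth \<Psi> 1 / 3 + w\<^sup>2"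
    "fps_nth A 4 = fps_nth \<Psi> 2 / 6 + 5 / 6 * w * fps_nth \<Psi> 1 + w ^ 3"
    using fps_convex_coeffs[OF A1 ode] unfolding \<Psi>0 by (simp_all add: field_simps)
  have "hankel_2_1 (log_inverse_coeff f) = B / 144"
    unfolding class_C_hankel[OF f, folded A_def] a B_def \<Psi>1[symmetric] \<Psi>2[symmetric]
    by (simp add: power2_eq_square power3_eq_cube power4_eq_xxxx field_simps)
  then have "norm (hankel_2_1 (log_inverse_coeff f)) = norm B / 144"
    by (simp only: norm_divide norm_numeral)
  moreover have "norm B \<le> 48 / 11"
    unfolding B_def by (rule schur_form_bound) (use xy \<psi>(1) in \<open>auto simp: schur_class_def w_def\<close>)
  ultimately show ?thesis by simp
qed

section \<open>The extremal function\<close>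

text \<open>The Cayley map onto the right half-plane, then the principal \<open>a\<close>-th power
  onto a sector, then the affine normalisation at the origin.\<close>

definition half_plane_power :: "real \<Rightarrow> complex \<Rightarrow> complex" where
  "half_plane_power a z = (exp (a * Ln ((1 + z) / (1 - z))) - 1) / (2 * a)"

lemma Re_cayley_pos:
  assumes "z \<in> ball 0 1"
  shows "0 < Re ((1 + z) / (1 - z))"
proof -
  have z: "norm z < 1" using assms by simp
  then have "(norm z)\<^sup>2 < 1" by (simp add: power_less_one_iff)
  moreover have "Re ((1 + z) / (1 - z)) = (1 - (norm z)\<^sup>2) / (norm (1 - z))\<^sup>2"
    unfolding Re_divide' cmod_power2 by (simp add: power2_eq_square algebra_simps)
  moreover have "1 - z \<noteq> 0" using z by auto
  ultimately show ?thesis by simp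
qed

lemma cayley_surj:
  assumes "0 < Re u"
  shows "\<exists>z \<in> ball 0 1. (1 + z) / (1 - z) = u"
proof
  have nz: "u + 1 \<noteq> 0" using assms by (auto simp: complex_eq_iff)
  have "(norm (u - 1))\<^sup>2 < (norm (u + 1))\<^sup>2"
    using assms unfolding cmod_power2 by (simp add: power2_eq_square algebra_simps)
  then have "norm (u - 1) < norm (u + 1)" by (rule power2_less_imp_less) simp
  then show "(u - 1) / (u + 1) \<in> ball 0 1"
    using nz by (simp add: norm_divide divide_less_eq_1)
  show "(1 + (u - 1) / (u + 1)) / (1 - (u - 1) / (u + 1)) = u"
    using nz by (simp add: divide_simps)
qed

lemma Im_Ln_cayley:
  assumes "z \<in> ball 0 1"
  shows "\<bar>Im (Ln ((1 + z) / (1 - z)))\<bar> < pi / 2"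
proof -
  have "0 < Re ((1 + z) / (1 - z))" by (rule Re_cayley_pos[OF assms])
  then show ?thesis using Re_Ln_pos_lt[of "(1 + z) / (1 - z)"] by force
qed

text \<open>For \<open>u\<close> in the right half-plane \<open>|Im (a Ln u)| < pi/2\<close>, so
  \<open>Ln\<close> undoes the exponential; the Cayley map is injective.\<close>

lemma half_plane_power_inj:
  assumes a: "0 < a" "a \<le> 1"
  shows "inj_on (half_plane_power a) (ball 0 1)"
proof (rule inj_onI)
  fix z w :: complex
  assume z: "z \<in> ball 0 1" and w: "w \<in> ball 0 1" and eq: "half_plane_power a z = half_plane_power a w"
  have Ln: "Ln (exp (a * Ln ((1 + x) / (1 - x)))) = a * Ln ((1 + x) / (1 - x))" if x: "x \<in> ball 0 1" for x
  proof (rule Ln_exp)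
    have "\<bar>a * Im (Ln ((1 + x) / (1 - x)))\<bar> \<le> 1 * \<bar>Im (Ln ((1 + x) / (1 - x)))\<bar>"
      unfolding abs_mult using a by (intro mult_right_mono) auto
    then show "- pi < Im (a * Ln ((1 + x) / (1 - x)))" "Im (a * Ln ((1 + x) / (1 - x))) \<le> pi"
      using Im_Ln_cayley[OF x] pi_gt_zero by (simp_all add: abs_le_iff abs_less_iff)
  qed
  have nz: "1 - z \<noteq> 0" "1 - w \<noteq> 0" using z w by auto
  have exp_Ln': "exp (Ln ((1 + x) / (1 - x))) = (1 + x) / (1 - x)" if "x \<in> ball 0 1" for x :: complex
    using Re_cayley_pos[OF that] by (intro exp_Ln) auto
  have "exp (a * Ln ((1 + z) / (1 - z))) = exp (a * Ln ((1 + w) / (1 - w)))"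
    using eq a by (simp add: half_plane_power_def)
  from arg_cong[OF this, of Ln] have "Ln ((1 + z) / (1 - z)) = Ln ((1 + w) / (1 - w))"
    unfolding Ln[OF z] Ln[OF w] using a by simp
  from arg_cong[OF this, of exp] have "(1 + z) / (1 - z) = (1 + w) / (1 - w)"
    unfolding exp_Ln'[OF z] exp_Ln'[OF w] .
  then have "(1 + z) * (1 - w) = (1 + w) * (1 - z)" using nz by (simp add: frac_eq_eq)
  then show "z = w" by (simp add: algebra_simps)
qed

text \<open>The exponential is rewritten as \<open>1 + 2 a f\<close>, which gives a linear
  differential equation and thereby a recursion for the coefficients.\<close>

lemma half_plane_power_deriv:
  assumes a: "0 < a" and z: "z \<in> ball 0 1"
  shows "(half_plane_power a has_field_derivative (1 + 2 * a * half_plane_power a z) / (1 - z\<^sup>2)) (at z)"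
proof -
  have nz: "1 - z \<noteq> 0" using z by auto
  have "0 < Re ((1 + z) / (1 - z))" by (rule Re_cayley_pos[OF z])
  then have nn: "(1 + z) / (1 - z) \<notin> \<real>\<^sub>\<le>\<^sub>0" and nz2: "1 + z \<noteq> 0"
    by (force simp: complex_nonpos_Reals_iff)+
  have sq: "1 - z\<^sup>2 = (1 - z) * (1 + z)" by (simp add: power2_eq_square algebra_simps)
  have "((\<lambda>z. (1 + z) / (1 - z)) has_field_derivative 2 / (1 - z)\<^sup>2) (at z)"
    by (rule derivative_eq_intros refl nz)+ (use nz in \<open>simp add: power2_eq_square\<close>)
  note DERIV_cmult[OF DERIV_chain2[OF has_field_derivative_Ln[OF nn] this], of a]
  note DERIV_cdivide[OF DERIV_diff[OF DERIV_chain2[OF DERIV_exp this] DERIV_const], of 1 "2 * of_real a"]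
  then show ?thesis
    unfolding half_plane_power_def sq
    by (rule DERIV_cong) (use a nz nz2 in \<open>simp add: divide_simps power2_eq_square\<close>)
qed

text \<open>The image is the sector \<open>|arg Z| < a pi/2\<close>. Being smaller than a
  half-plane, it is the intersection of the two rotations of the right half-plane by
  \<open>\<beta>\<close>, the complement of \<open>a pi/2\<close>; convexity is then
  immediate.\<close>

lemma exp_half_plane_image:
  assumes a: "0 < a" "a < 1"
  defines "\<beta> \<equiv> (1 - a) * (pi / 2)"
  shows "(\<lambda>z. exp (a * Ln ((1 + z) / (1 - z)))) ` ball 0 1 =
    {Z. 0 < Re (cis \<beta> * Z)} \<inter> {Z. 0 < Re (cis (- \<beta>) * Z)}"
proof -
  have \<beta>: "0 < \<beta>" "\<beta> < pi / 2" "a * (pi / 2) = pi / 2 - \<beta>"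
    using a by (simp_all add: \<beta>_def field_simps)
  have Re: "Re (cis t * exp v) = exp (Re v) * cos (t + Im v)" for t v
    by (simp add: exp_eq_polar cis_mult mult.left_commute[of "cis t"])
  show ?thesis
  proof (intro equalityI subsetI)
    fix Z assume "Z \<in> (\<lambda>z. exp (a * Ln ((1 + z) / (1 - z)))) ` ball 0 1"
    then obtain z where z: "z \<in> ball 0 1" and Z: "Z = exp (a * Ln ((1 + z) / (1 - z)))" by blast
    define v where "v = a * Ln ((1 + z) / (1 - z))"
    have "\<bar>Im v\<bar> = a * \<bar>Im (Ln ((1 + z) / (1 - z)))\<bar>"
      using a by (simp add: v_def abs_mult)
    also have "\<dots> < a * (pi / 2)"
      using Im_Ln_cayley[OF z] a by (intro mult_strict_left_mono) auto
    finally have "\<bar>Im v\<bar> < pi / 2 - \<beta>" using \<beta> by simp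
    then have "0 < cos (\<beta> + Im v)" "0 < cos (- \<beta> + Im v)"
      using \<beta> by (intro cos_gt_zero_pi; simp add: abs_less_iff)+
    then show "Z \<in> {Z. 0 < Re (cis \<beta> * Z)} \<inter> {Z. 0 < Re (cis (- \<beta>) * Z)}"
      unfolding Z v_def[symmetric] by (simp only: Int_iff mem_Collect_eq Re) simp
  next
    fix Z assume Z: "Z \<in> {Z. 0 < Re (cis \<beta> * Z)} \<inter> {Z. 0 < Re (cis (- \<beta>) * Z)}"
    then have "Z \<noteq> 0" by auto
    define v where "v = Ln Z"
    have Zv: "Z = exp v" using \<open>Z \<noteq> 0\<close> by (simp add: v_def)
    have Imv: "- pi < Im v" "Im v \<le> pi" using mpi_less_Im_Ln Im_Ln_le_pi \<open>Z \<noteq> 0\<close> by (auto simp: v_def)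
    have c: "0 < cos (\<beta> + Im v)" "0 < cos (- \<beta> + Im v)"
      using Z unfolding Zv by (simp_all only: Int_iff mem_Collect_eq Re zero_less_mult_iff) auto
    have "\<bar>Im v\<bar> < pi / 2 - \<beta>"
    proof (rule ccontr)
      assume "\<not> \<bar>Im v\<bar> < pi / 2 - \<beta>"
      then have t: "pi / 2 - \<beta> \<le> \<bar>Im v\<bar>" "\<bar>Im v\<bar> \<le> pi" using Imv by auto
      \<comment> \<open>By symmetry of the two conditions, only \<open>|Im v|\<close>
        matters.\<close>
      have "cos (- Im v + \<beta>) = cos (- \<beta> + Im v)"
        using cos_minus[of "- Im v + \<beta>"] by (simp add: add.commute)
      then have "0 < cos (\<bar>Im v\<bar> + \<beta>)"
        using c by (cases "0 \<le> Im v"; simp add: add.commute)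
      \<comment> \<open>\<open>|Im v| + \<beta>\<close> lies between \<open>pi/2\<close> and
        \<open>3 pi/2\<close>, where the cosine is not positive.\<close>
      moreover have "0 \<le> cos (\<bar>Im v\<bar> + \<beta> - pi)"
        using t \<beta> by (intro cos_ge_zero) auto
      ultimately show False by (simp add: cos_minus_pi)
    qed
    then have "\<bar>Im v\<bar> / a < pi / 2" using a \<beta> by (simp add: divide_less_eq mult.commute)
    then have Im: "\<bar>Im (v / a)\<bar> < pi / 2" using a by (simp add: abs_divide)
    then have Im': "- (pi / 2) < Im (v / a)" "Im (v / a) < pi / 2" by linarith+
    then have "0 < Re (exp (v / a))"
      unfolding Re_exp by (intro mult_pos_pos cos_gt_zero_pi Im') simp
    then obtain z where z: "z \<in> ball 0 1" "(1 + z) / (1 - z) = exp (v / a)"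
      using cayley_surj by blast
    moreover have "Ln (exp (v / a)) = v / a"
      by (intro Ln_exp) (use Im' pi_gt_zero in linarith)+
    ultimately have "Z = exp (a * Ln ((1 + z) / (1 - z)))" using a by (simp add: Zv)
    then show "Z \<in> (\<lambda>z. exp (a * Ln ((1 + z) / (1 - z)))) ` ball 0 1" using z(1) by blast
  qed
qed

lemma half_plane_power_convex:
  assumes a: "0 < a" "a < 1"
  shows "convex (half_plane_power a ` ball 0 1)"
proof -
  have half: "convex {Z. 0 < Re (c * Z)}" for c
    using convex_halfspace_gt[of 0 "cnj c"] by (simp add: inner_complex_def)
  have "half_plane_power a ` ball 0 1 =
      (\<lambda>x. of_real (- (1 / (2 * a))) + (1 / (2 * a)) *\<^sub>R x) ` (\<lambda>z. exp (a * Ln ((1 + z) / (1 - z)))) ` ball 0 1"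
    unfolding image_image half_plane_power_def
    using a by (intro image_cong refl) (simp add: scaleR_conv_of_real diff_divide_distrib)
  also have "convex \<dots>"
    unfolding exp_half_plane_image[OF a] by (intro convex_affinity convex_Int half)
  finally show ?thesis .
qed

lemma half_plane_power_class_C:
  assumes a: "0 < a" "a < 1"
  shows "half_plane_power a \<in> class_C"
proof -
  have "half_plane_power a holomorphic_on ball 0 1"
    by (rule holomorphic_onI) (meson a half_plane_power_deriv field_differentiable_def has_field_derivative_at_within)
  moreover have "half_plane_power a 0 = 0" by (simp add: half_plane_power_def)
  moreover have "deriv (half_plane_power a) 0 = 1"
    using DERIV_imp_deriv[OF half_plane_power_deriv[OF a(1), of 0]] by (simp add: half_plane_power_def)
  ultimately show ?thesis
    using half_plane_power_inj[of a] half_plane_power_convex[OF a] a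
    by (simp add: class_C_def class_S_def class_A_def)
qed

lemma half_plane_power_coeffs:
  assumes a: "0 < a" "a < 1"
  defines "A \<equiv> fps_expansion (half_plane_power a) 0"
  shows "fps_nth A 2 = a" and "fps_nth A 3 = (1 + 2 * (of_real a)\<^sup>2) / 3"
    and "fps_nth A 4 = (2 * of_real a + of_real a ^ 3) / 3"
proof -
  note C = class_C_D[OF half_plane_power_class_C[OF a]]
  have e: "half_plane_power a has_fps_expansion A"
    unfolding A_def using has_fps_expansion_ball[OF C(1)] by simp
  have "(1 - fps_X ^ 2) * fps_deriv A = 1 + fps_const (2 * of_real a) * A"
  proof (rule fps_eq_of_eq_on_ball)
    show "(\<lambda>z. (1 - z\<^sup>2) * deriv (half_plane_power a) z) has_fps_expansion (1 - fps_X ^ 2) * fps_deriv A"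
      by (intro fps_expansion_intros has_fps_expansion_deriv e)
    show "(\<lambda>z. 1 + 2 * of_real a * half_plane_power a z) has_fps_expansion 1 + fps_const (2 * of_real a) * A"
      by (intro fps_expansion_intros e)
    fix z :: complex assume z: "z \<in> ball 0 1"
    then have "(norm z)\<^sup>2 < 1" by (simp add: power_less_one_iff)
    then have "1 - z\<^sup>2 \<noteq> 0" by (metis norm_one norm_power eq_iff_diff_eq_0 less_irrefl)
    then show "(1 - z\<^sup>2) * deriv (half_plane_power a) z = 1 + 2 * of_real a * half_plane_power a z"
      using DERIV_imp_deriv[OF half_plane_power_deriv[OF a(1) z]] by simp
  qed simp
  then have eq: "fps_deriv A - fps_X ^ 2 * fps_deriv A = 1 + fps_const (2 * of_real a) * A"
    by (simp add: left_diff_distrib)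
  \<comment> \<open>For \<open>n >= 2\<close> the subtracted term is \<open>n - 1\<close> times the
    coefficient of order \<open>n - 1\<close>, so \<open>n = 1, 2, 3\<close> yield the coefficients
    of order 2, 3, 4 in turn.\<close>
  have N: "fps_nth (fps_deriv A) n - (if n < 2 then 0 else fps_nth (fps_deriv A) (n - 2)) =
      (if n = 0 then 1 else 0) + 2 * of_real a * fps_nth A n" for n
    using arg_cong[OF eq, of "\<lambda>F. fps_nth F n"] by (simp add: fps_X_power_mult_nth)
  have A: "fps_nth A 0 = 0" "fps_nth A 1 = 1"
    using C(2,3) by (simp_all add: A_def fps_expansion_def)
  show 2: "fps_nth A 2 = a"
    using N[of 1] A by (simp flip: numeral_2_eq_2)
  show 3: "fps_nth A 3 = (1 + 2 * (of_real a)\<^sup>2) / 3"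
    using N[of 2] A 2 by (simp add: power2_eq_square field_simps flip: numeral_3_eq_3)
  have "12 * fps_nth A 4 = 8 * of_real a + 4 * of_real a ^ 3"
    using N[of 3] 2 3 by (simp add: power2_eq_square power3_eq_cube field_simps flip: numeral_2_eq_2)
  then have "12 * fps_nth A 4 = 12 * ((2 * of_real a + of_real a ^ 3) / 3)" by simp
  then show "fps_nth A 4 = (2 * of_real a + of_real a ^ 3) / 3"
    by (rule mult_left_cancel[THEN iffD1, rotated]) simp
qed

text \<open>For \<open>half_plane_power a\<close> the determinant is
  \<open>- (4 + 4 a^2 - 11 a^4) / 144\<close>; \<open>a^2 = 2/11\<close> maximises the bracket, with
  value \<open>48/11\<close>.\<close>

lemma half_plane_power_extremal:
  defines "a \<equiv> sqrt (2 / 11)"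
  shows "half_plane_power a \<in> class_C" and "norm (hankel_2_1 (log_inverse_coeff (half_plane_power a))) = 1 / 33"
proof -
  have a: "0 < a" "a < 1" by (simp_all add: a_def)
  then show C: "half_plane_power a \<in> class_C" by (rule half_plane_power_class_C)
  have a2: "(complex_of_real a)\<^sup>2 = 2 / 11"
    unfolding of_real_power[symmetric] a_def by simp
  have a4: "complex_of_real a ^ 4 = 4 / 121"
    using arg_cong[OF a2, of "\<lambda>x. x\<^sup>2"] by (simp add: power_divide flip: power_mult)
  \<comment> \<open>After this rewriting only even powers of \<open>a\<close> remain, so the square
    root disappears.\<close>
  have eq: "12 * of_real a * ((2 * complex_of_real a + complex_of_real a ^ 3) / 3) = 8 * (complex_of_real a)\<^sup>2 + 4 * complex_of_real a ^ 4"
    by (simp add: power2_eq_square power3_eq_cube power4_eq_xxxx algebra_simps)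
  have "hankel_2_1 (log_inverse_coeff (half_plane_power a)) = - (1 / 33)"
    unfolding class_C_hankel[OF C] half_plane_power_coeffs[OF a] eq a2 a4 by (simp add: power_divide)
  then show "norm (hankel_2_1 (log_inverse_coeff (half_plane_power a))) = 1 / 33"
    by (simp add: norm_divide)
qed

theorem theorem3p1:
  shows "(\<forall>f \<in> class_C. norm (hankel_2_1 (log_inverse_coeff f)) \<le> 1 / 33) \<and>
         (\<exists>f \<in> class_C. norm (hankel_2_1 (log_inverse_coeff f)) = 1 / 33)"
  using class_C_hankel_bound half_plane_power_extremal by blast

end
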